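(* Let $\mathcal{T}$ be a $k$-linear, Hom-finite, Krull-Schmidt triangulated category equipped with a linear generator $G$. Suppose that $X\in\langle G\rangle_2$ is an indecomposable object. Then $X$ is either isomorphic to an object $P\in\langle G\rangle_1$ or to $X_{P,Q}$, where $P,Q$ are indecomposable objects in $\langle G\rangle_1$.
   Context: $k$ is an algebraically closed field. For a triangulated category $\mathcal{T}$ with suspension $[1]$, write $\mathcal{T}(X,Y)$ for the space of morphisms $X\to Y$. For $X\in\mathcal{T}$: $\langle X\rangle$ is the smallest thick subcategory containing $X$; $\langle X\rangle_1$ is the smallest full additive subcategory of $\mathcal{T}$ containing $X$ and closed under direct summands and under the suspension functor and its inverse; $\langle X\rangle_2$ is the full subcategory of objects $A$ fitting into a triangle $B\to A\to C\to B[1]$ with $B,C\in\langle X\rangle_1$. $G$ is a classical generator if $\langle G\rangle=\mathcal{T}$. A linear generator is a classical generator $G$ such that: (G1) the isomorphism classes of indecomposable objects of $\langle G\rangle_1$ are totally ordered by: $Q\le P$ if and only if $\mathcal{T}(P,Q)\cong k$; moreover if $Q\le P$ and $Q\not\cong P$ then $\mathcal{T}(Q,P)=0$; (G2) $P\le P[1]$ for each indecomposable $P\in\langle G\rangle_1$; (G3) for indecomposables $P,Q\in\langle G\rangle_1$, $P\le Q\le P[1]$ implies $Q\cong P$ or $Q\cong P[1]$; (G4) for indecomposables $R\le Q\le P$ in $\langle G\rangle_1$, any (nonzero) morphism $P\to R$ factors as a composite $P\to Q\to R$. We write $Q<P$ if $Q\le P$ and $Q\not\cong P$. For indecomposables $Q<P$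 in $\langle G\rangle_1$, $X_{P,Q}$ denotes the cone of any nonzero morphism $P\to Q$ (well defined up to isomorphism since $\mathcal{T}(P,Q)\cong k$). *)

theory Defs
  imports "HOL-Computational_Algebra.Polynomial"
begin

section \<open>Linear triangulated categories\<close>

text \<open>
  The objects of the category are the elements of the type \<open>'o\<close>. The morphism spaces
  \<open>Hom T X Y\<close> are linear subspaces of one ambient \<open>'k\<close>-vector space \<open>'m\<close>, in which they
  need not be disjoint (they all contain \<open>0\<close>). This loses no generality: take for \<open>'m\<close> the
  direct sum of all morphism spaces. Composition \<open>g \<cdot>\<^bsub>T\<^esub> f\<close> ("g after f") and the
  action of the suspension on morphisms are only meaningful, and only constrained, on composable
  morphisms and on morphisms, respectively. \<open>Dist T X Y Z f g h\<close> says that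
  \<open>X \<rightarrow> Y \<rightarrow> Z \<rightarrow> X[1]\<close> with maps \<open>f, g, h\<close> is a distinguished triangle.
\<close>

record ('o, 'm, 'k) tri_data =
  Scale :: "'k \<Rightarrow> 'm \<Rightarrow> 'm"
  Hom :: "'o \<Rightarrow> 'o \<Rightarrow> 'm set"
  Idn :: "'o \<Rightarrow> 'm"
  Comp :: "'m \<Rightarrow> 'm \<Rightarrow> 'm"  (infixr "\<cdot>\<index>" 75)
  Susp :: "'o \<Rightarrow> 'o"
  SuspM :: "'m \<Rightarrow> 'm"
  Dist :: "'o \<Rightarrow> 'o \<Rightarrow> 'o \<Rightarrow> 'm \<Rightarrow> 'm \<Rightarrow> 'm \<Rightarrow> bool"

definition is_iso :: "('o, 'm, 'k) tri_data \<Rightarrow> 'o \<Rightarrow> 'o \<Rightarrow> 'm \<Rightarrow> bool" where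
  "is_iso T X Y f \<longleftrightarrow> f \<in> Hom T X Y \<and>
     (\<exists>g\<in>Hom T Y X. g \<cdot>\<^bsub>T\<^esub> f = Idn T X \<and> f \<cdot>\<^bsub>T\<^esub> g = Idn T Y)"

definition isomorphic :: "('o, 'm, 'k) tri_data \<Rightarrow> 'o \<Rightarrow> 'o \<Rightarrow> bool" where
  "isomorphic T X Y \<longleftrightarrow> (\<exists>f. is_iso T X Y f)"

definition zero_object :: "('o, 'm::zero, 'k) tri_data \<Rightarrow> 'o \<Rightarrow> bool" where
  "zero_object T Z \<longleftrightarrow> (\<forall>X. Hom T X Z = {0} \<and> Hom T Z X = {0})"

text \<open>\<open>X\<close> is a direct sum (biproduct) of the finite list \<open>As\<close>; determined up to isomorphism.\<close>

definition direct_sum :: "('o, 'm::ab_group_add, 'k) tri_data \<Rightarrow> 'o list \<Rightarrow> 'o \<Rightarrow> bool" where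
  "direct_sum T As X \<longleftrightarrow> (\<exists>inj prj.
     (\<forall>i<length As. inj i \<in> Hom T (As ! i) X \<and> prj i \<in> Hom T X (As ! i)) \<and>
     (\<forall>i<length As. \<forall>j<length As.
        prj i \<cdot>\<^bsub>T\<^esub> inj j = (if i = j then Idn T (As ! i) else 0)) \<and>
     (\<Sum>i<length As. inj i \<cdot>\<^bsub>T\<^esub> prj i) = Idn T X)"

definition indecomposable :: "('o, 'm::ab_group_add, 'k) tri_data \<Rightarrow> 'o \<Rightarrow> bool" where
  "indecomposable T X \<longleftrightarrow> \<not> zero_object T X \<and>
     (\<forall>A B. direct_sum T [A, B] X \<longrightarrow> zero_object T A \<or> zero_object T B)"

definition local_endomorphism_ring :: "('o, 'm::ab_group_add, 'k) tri_data \<Rightarrow> 'o \<Rightarrow> bool" where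
  "local_endomorphism_ring T X \<longleftrightarrow> Idn T X \<noteq> 0 \<and>
     (\<forall>f\<in>Hom T X X. \<forall>g\<in>Hom T X X.
        \<not> is_iso T X X f \<longrightarrow> \<not> is_iso T X X g \<longrightarrow> \<not> is_iso T X X (f + g))"

locale linear_category =
  fixes T :: "('o, 'm::ab_group_add, 'k::field) tri_data" (structure)
  assumes vector_space: "vector_space (Scale T)"
    and hom_subspace: "module.subspace (Scale T) (Hom T X Y)"
    and idn_hom: "Idn T X \<in> Hom T X X"
    and comp_hom: "\<lbrakk>f \<in> Hom T X Y; g \<in> Hom T Y Z\<rbrakk> \<Longrightarrow> g \<cdot> f \<in> Hom T X Z"
    and comp_assoc: "\<lbrakk>f \<in> Hom T W X; g \<in> Hom T X Y; h \<in> Hom T Y Z\<rbrakk> \<Longrightarrow> (h \<cdot> g) \<cdot> f = h \<cdot> (g \<cdot> f)"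
    and comp_idn_left: "f \<in> Hom T X Y \<Longrightarrow> Idn T Y \<cdot> f = f"
    and comp_idn_right: "f \<in> Hom T X Y \<Longrightarrow> f \<cdot> Idn T X = f"
    and comp_add_left:
      "\<lbrakk>f \<in> Hom T X Y; g \<in> Hom T Y Z; g' \<in> Hom T Y Z\<rbrakk> \<Longrightarrow> (g + g') \<cdot> f = g \<cdot> f + g' \<cdot> f"
    and comp_add_right:
      "\<lbrakk>f \<in> Hom T X Y; f' \<in> Hom T X Y; g \<in> Hom T Y Z\<rbrakk> \<Longrightarrow> g \<cdot> (f + f') = g \<cdot> f + g \<cdot> f'"
    and comp_scale_left:
      "\<lbrakk>f \<in> Hom T X Y; g \<in> Hom T Y Z\<rbrakk> \<Longrightarrow> Scale T c g \<cdot> f = Scale T c (g \<cdot> f)"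
    and comp_scale_right:
      "\<lbrakk>f \<in> Hom T X Y; g \<in> Hom T Y Z\<rbrakk> \<Longrightarrow> g \<cdot> Scale T c f = Scale T c (g \<cdot> f)"

locale linear_additive_category = linear_category T
  for T :: "('o, 'm::ab_group_add, 'k::field) tri_data" (structure) +
  assumes zero_object_exists: "\<exists>Z. zero_object T Z"
    and direct_sum_exists: "\<exists>Z. direct_sum T [X, Y] Z"

text \<open>
  The suspension is a \<open>'k\<close>-linear autoequivalence: fully faithful and essentially surjective.
  Automorphisms of the category are a special case.
\<close>

locale linear_triangulated_category = linear_additive_category T
  for T :: "('o, 'm::ab_group_add, 'k::field) tri_data" (structure) +
  assumes susp_idn: "SuspM T (Idn T X) = Idn T (Susp T X)"
    and susp_comp:
      "\<lbrakk>f \<in> Hom T X Y; g \<in> Hom T Y Z\<rbrakk> \<Longrightarrow> SuspM T (g \<cdot> f) = SuspM T g \<cdot> SuspM T f"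
    and susp_add:
      "\<lbrakk>f \<in> Hom T X Y; g \<in> Hom T X Y\<rbrakk> \<Longrightarrow> SuspM T (f + g) = SuspM T f + SuspM T g"
    and susp_scale: "f \<in> Hom T X Y \<Longrightarrow> SuspM T (Scale T c f) = Scale T c (SuspM T f)"
    and susp_fully_faithful: "bij_betw (SuspM T) (Hom T X Y) (Hom T (Susp T X) (Susp T Y))"
    and susp_essentially_surjective: "\<exists>X. isomorphic T (Susp T X) Y"
    and dist_hom: "Dist T X Y Z f g h \<Longrightarrow>
      f \<in> Hom T X Y \<and> g \<in> Hom T Y Z \<and> h \<in> Hom T Z (Susp T X)"
    and dist_iso: "\<lbrakk>Dist T X Y Z f g h;
      f' \<in> Hom T X' Y'; g' \<in> Hom T Y' Z'; h' \<in> Hom T Z' (Susp T X');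
      is_iso T X X' p; is_iso T Y Y' q; is_iso T Z Z' r;
      q \<cdot> f = f' \<cdot> p; r \<cdot> g = g' \<cdot> q; SuspM T p \<cdot> h = h' \<cdot> r\<rbrakk>
      \<Longrightarrow> Dist T X' Y' Z' f' g' h'"
    and TR1_idn: "zero_object T Z \<Longrightarrow> Dist T X X Z (Idn T X) 0 0"
    and TR1_cone: "f \<in> Hom T X Y \<Longrightarrow> \<exists>Z g h. Dist T X Y Z f g h"
    and TR2: "\<lbrakk>f \<in> Hom T X Y; g \<in> Hom T Y Z; h \<in> Hom T Z (Susp T X)\<rbrakk>
      \<Longrightarrow> Dist T X Y Z f g h \<longleftrightarrow> Dist T Y Z (Susp T X) g h (- SuspM T f)"
    and TR3: "\<lbrakk>Dist T X Y Z f g h; Dist T X' Y' Z' f' g' h';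
      a \<in> Hom T X X'; b \<in> Hom T Y Y'; b \<cdot> f = f' \<cdot> a\<rbrakk>
      \<Longrightarrow> \<exists>c\<in>Hom T Z Z'. c \<cdot> g = g' \<cdot> b \<and> SuspM T a \<cdot> h = h' \<cdot> c"
    and TR4: "\<lbrakk>Dist T X Y Z' f u u'; Dist T Y Z X' g v v'; Dist T X Z Y' (g \<cdot> f) w w'\<rbrakk>
      \<Longrightarrow> \<exists>a\<in>Hom T Z' Y'. \<exists>b\<in>Hom T Y' X'.
            Dist T Z' Y' X' a b (SuspM T u \<cdot> v') \<and>
            a \<cdot> u = w \<cdot> g \<and> w' \<cdot> a = u' \<and> b \<cdot> w = v \<and> v' \<cdot> b = SuspM T f \<cdot> w'"

locale hom_finite_KS_triangulated_category = linear_triangulated_category T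
  for T :: "('o, 'm::ab_group_add, 'k::field) tri_data" (structure) +
  assumes hom_finite: "\<exists>B. finite B \<and> Hom T X Y = module.span (Scale T) B"
    and krull_schmidt:
      "\<exists>As. (\<forall>A\<in>set As. local_endomorphism_ring T A) \<and> direct_sum T As X"


section \<open>Generated subcategories\<close>

text \<open>
  Full subcategories are represented by their sets of objects. Closure under direct summands
  includes closure under isomorphism, since \<open>A \<cong> X\<close> is a summand of \<open>X\<close> with zero complement.
  For such subcategories, closure under a quasi-inverse of the suspension means that
  \<open>Susp T A \<in> S\<close> implies \<open>A \<in> S\<close>.
\<close>

definition susp_closed :: "('o, 'm, 'k) tri_data \<Rightarrow> 'o set \<Rightarrow> bool" where
  "susp_closed T S \<longleftrightarrow> (\<forall>A. Susp T A \<in> S \<longleftrightarrow> A \<in> S)"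

definition summand_closed :: "('o, 'm::ab_group_add, 'k) tri_data \<Rightarrow> 'o set \<Rightarrow> bool" where
  "summand_closed T S \<longleftrightarrow> (\<forall>A B X. direct_sum T [A, B] X \<longrightarrow> X \<in> S \<longrightarrow> A \<in> S \<and> B \<in> S)"

definition additive_subcategory :: "('o, 'm::ab_group_add, 'k) tri_data \<Rightarrow> 'o set \<Rightarrow> bool" where
  "additive_subcategory T S \<longleftrightarrow> (\<forall>Z. zero_object T Z \<longrightarrow> Z \<in> S) \<and>
     (\<forall>A B X. direct_sum T [A, B] X \<longrightarrow> A \<in> S \<longrightarrow> B \<in> S \<longrightarrow> X \<in> S)"

definition thick_subcategory :: "('o, 'm::ab_group_add, 'k) tri_data \<Rightarrow> 'o set \<Rightarrow> bool" where
  "thick_subcategory T S \<longleftrightarrow>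
     additive_subcategory T S \<and> susp_closed T S \<and> summand_closed T S \<and>
     (\<forall>A B C f g h. Dist T A B C f g h \<longrightarrow> A \<in> S \<longrightarrow> B \<in> S \<longrightarrow> C \<in> S)"

definition thick_closure :: "('o, 'm::ab_group_add, 'k) tri_data \<Rightarrow> 'o \<Rightarrow> 'o set" where
  "thick_closure T X = \<Inter>{S. thick_subcategory T S \<and> X \<in> S}"

definition gen1 :: "('o, 'm::ab_group_add, 'k) tri_data \<Rightarrow> 'o \<Rightarrow> 'o set" where
  "gen1 T X = \<Inter>{S. additive_subcategory T S \<and> summand_closed T S \<and> susp_closed T S \<and> X \<in> S}"

definition gen2 :: "('o, 'm::ab_group_add, 'k) tri_data \<Rightarrow> 'o \<Rightarrow> 'o set" where
  "gen2 T X = {A. \<exists>B C f g h. B \<in> gen1 T X \<and> C \<in> gen1 T X \<and> Dist T B A C f g h}"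

definition classical_generator :: "('o, 'm::ab_group_add, 'k) tri_data \<Rightarrow> 'o \<Rightarrow> bool" where
  "classical_generator T G \<longleftrightarrow> thick_closure T G = UNIV"


section \<open>Linear generators\<close>

definition hom_iso_field :: "('o, 'm::ab_group_add, 'k::field) tri_data \<Rightarrow> 'o \<Rightarrow> 'o \<Rightarrow> bool" where
  "hom_iso_field T X Y \<longleftrightarrow> (\<exists>\<phi>. bij_betw \<phi> (Hom T X Y) (UNIV :: 'k set) \<and>
     (\<forall>f\<in>Hom T X Y. \<forall>g\<in>Hom T X Y. \<phi> (f + g) = \<phi> f + \<phi> g) \<and>
     (\<forall>c. \<forall>f\<in>Hom T X Y. \<phi> (Scale T c f) = c * \<phi> f))"

definition ind1 :: "('o, 'm::ab_group_add, 'k) tri_data \<Rightarrow> 'o \<Rightarrow> 'o set" where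
  "ind1 T G = {P \<in> gen1 T G. indecomposable T P}"

text \<open>\<open>gle T Q P\<close> is \<open>Q \<le> P\<close>; note that the morphisms go from the larger object to the smaller.\<close>

definition gle :: "('o, 'm::ab_group_add, 'k::field) tri_data \<Rightarrow> 'o \<Rightarrow> 'o \<Rightarrow> bool" where
  "gle T Q P \<longleftrightarrow> hom_iso_field T P Q"

definition glt :: "('o, 'm::ab_group_add, 'k::field) tri_data \<Rightarrow> 'o \<Rightarrow> 'o \<Rightarrow> bool" where
  "glt T Q P \<longleftrightarrow> gle T Q P \<and> \<not> isomorphic T Q P"

definition iso_class :: "('o, 'm, 'k) tri_data \<Rightarrow> 'o \<Rightarrow> 'o set" where
  "iso_class T X = {Y. isomorphic T X Y}"

definition linear_generator :: "('o, 'm::ab_group_add, 'k::field) tri_data \<Rightarrow> 'o \<Rightarrow> bool" where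
  "linear_generator T G \<longleftrightarrow> classical_generator T G \<and>
     \<comment> \<open>(G1)\<close>
     linear_order_on (iso_class T ` ind1 T G)
       {(iso_class T Q, iso_class T P) | Q P. Q \<in> ind1 T G \<and> P \<in> ind1 T G \<and> gle T Q P} \<and>
     (\<forall>P\<in>ind1 T G. \<forall>Q\<in>ind1 T G. gle T Q P \<and> \<not> isomorphic T Q P \<longrightarrow> Hom T Q P = {0}) \<and>
     \<comment> \<open>(G2)\<close>
     (\<forall>P\<in>ind1 T G. gle T P (Susp T P)) \<and>
     \<comment> \<open>(G3)\<close>
     (\<forall>P\<in>ind1 T G. \<forall>Q\<in>ind1 T G. gle T P Q \<and> gle T Q (Susp T P) \<longrightarrow>
        isomorphic T Q P \<or> isomorphic T Q (Susp T P)) \<and>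
     \<comment> \<open>(G4)\<close>
     (\<forall>P\<in>ind1 T G. \<forall>Q\<in>ind1 T G. \<forall>R\<in>ind1 T G. gle T R Q \<and> gle T Q P \<longrightarrow>
        (\<forall>f\<in>Hom T P R. f \<noteq> 0 \<longrightarrow> (\<exists>g\<in>Hom T P Q. \<exists>h\<in>Hom T Q R. f = h \<cdot>\<^bsub>T\<^esub> g)))"

text \<open>
  The object \<open>X\<^sub>P\<^sub>,\<^sub>Q\<close>: a chosen cone of a nonzero morphism \<open>P \<rightarrow> Q\<close>. For indecomposables \<open>Q < P\<close>
  of \<open>gen1 T G\<close> such a cone exists, and it is unique up to isomorphism because \<open>Hom T P Q\<close> is
  one-dimensional.
\<close>

definition cone_obj :: "('o, 'm::zero, 'k) tri_data \<Rightarrow> 'o \<Rightarrow> 'o \<Rightarrow> 'o" where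
  "cone_obj T P Q = (SOME Z. \<exists>f\<in>Hom T P Q. f \<noteq> 0 \<and> (\<exists>g h. Dist T P Q Z f g h))"

end

theory Submission
  imports Defs
begin

text \<open>
  An object \<open>X\<close> of \<open>gen2 T G\<close> is the cone of a morphism \<open>f : A \<rightarrow> B\<close> with \<open>A\<close> and \<open>B\<close> in \<open>gen1 T G\<close>.
  By the Krull-Schmidt property \<open>A\<close> and \<open>B\<close> are finite direct sums of indecomposables of
  \<open>gen1 T G\<close>, and \<open>f\<close> is a matrix whose entries lie in morphism spaces of dimension at most one.
  The idea is to diagonalise this matrix by Gaussian elimination.

  Suppose that \<open>f \<noteq> 0\<close>. Among the summands of \<open>A\<close> on which \<open>f\<close> is nonzero let \<open>P\<close> be a minimal one,
  and among the summands of \<open>B\<close> that receive a nonzero entry from \<open>P\<close> let \<open>Q\<close> be a maximal one. By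
  (G4) all entries in the row and the column of \<open>u : P \<rightarrow> Q\<close> factor through \<open>u\<close> (lemma \<open>pivot\<close>), so
  after a change of the complements of \<open>P\<close> and \<open>Q\<close> the morphism \<open>f\<close> becomes \<open>u \<oplus> f'\<close>, where \<open>f'\<close> has
  fewer summands in its source. The cone of a direct sum is the direct sum of the cones (lemma
  \<open>sum_decomp_cone\<close>), so the indecomposable \<open>X\<close> is the cone of \<open>u\<close> or the cone of \<open>f'\<close>. In the first
  case \<open>u\<close> is not invertible, because \<open>X \<noteq> 0\<close>, whence \<open>Q < P\<close> and \<open>X\<close> is the object \<open>X\<^sub>P\<^sub>,\<^sub>Q\<close>. In
  the second case induction applies. If \<open>f = 0\<close>, then \<open>X\<close> is the direct sum of \<open>B\<close> and the suspension
  of \<open>A\<close>, hence in \<open>gen1 T G\<close>.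
\<close>

section \<open>Calculus in a linear category\<close>

context linear_category
begin

lemma module_scale: "module (Scale T)"
  using vector_space by (simp add: module_iff_vector_space)

lemma zero_hom: "0 \<in> Hom T X Y"
  by (rule module.subspace_0[OF module_scale hom_subspace])

lemma diff_hom: "\<lbrakk>f \<in> Hom T X Y; g \<in> Hom T X Y\<rbrakk> \<Longrightarrow> f - g \<in> Hom T X Y"
  by (rule module.subspace_diff[OF module_scale hom_subspace])

lemma uminus_hom: "f \<in> Hom T X Y \<Longrightarrow> - f \<in> Hom T X Y"
  by (rule module.subspace_neg[OF module_scale hom_subspace])

lemma scale_hom: "f \<in> Hom T X Y \<Longrightarrow> Scale T c f \<in> Hom T X Y"
  by (rule module.subspace_scale[OF module_scale hom_subspace])

lemma sum_hom: "(\<And>k. k \<in> I \<Longrightarrow> f k \<in> Hom T X Y) \<Longrightarrow> (\<Sum>k\<in>I. f k) \<in> Hom T X Y"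
  by (rule module.subspace_sum[OF module_scale hom_subspace])

lemma comp_zero_left: "f \<in> Hom T X Y \<Longrightarrow> 0 \<cdot> f = 0"
  using comp_add_left[OF _ zero_hom zero_hom] by fastforce

lemma comp_zero_right: "g \<in> Hom T Y Z \<Longrightarrow> g \<cdot> 0 = 0"
  using comp_add_right[OF zero_hom zero_hom] by fastforce

lemma comp_diff_left:
  assumes "f \<in> Hom T X Y" "g \<in> Hom T Y Z" "g' \<in> Hom T Y Z"
  shows "(g - g') \<cdot> f = g \<cdot> f - g' \<cdot> f"
  using comp_add_left[OF assms(1) diff_hom[OF assms(2,3)] assms(3)] by (simp add: algebra_simps)

lemma comp_diff_right:
  assumes "f \<in> Hom T X Y" "f' \<in> Hom T X Y" "g \<in> Hom T Y Z"
  shows "g \<cdot> (f - f') = g \<cdot> f - g \<cdot> f'"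
  using comp_add_right[OF diff_hom[OF assms(1,2)] assms(2,3)] by (simp add: algebra_simps)

lemma comp_sum_left:
  assumes "f \<in> Hom T X Y" "\<And>k. k \<in> I \<Longrightarrow> g k \<in> Hom T Y Z"
  shows "(\<Sum>k\<in>I. g k) \<cdot> f = (\<Sum>k\<in>I. g k \<cdot> f)"
  using assms(2)
proof (induction I rule: infinite_finite_induct)
  case (insert a I)
  then have "(g a + (\<Sum>k\<in>I. g k)) \<cdot> f = g a \<cdot> f + (\<Sum>k\<in>I. g k) \<cdot> f"
    by (intro comp_add_left[OF assms(1), of _ Z] sum_hom) auto
  with insert show ?case by simp
qed (simp_all add: comp_zero_left[OF assms(1)])

lemma comp_sum_right:
  assumes "g \<in> Hom T Y Z" "\<And>k. k \<in> I \<Longrightarrow> f k \<in> Hom T X Y"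
  shows "g \<cdot> (\<Sum>k\<in>I. f k) = (\<Sum>k\<in>I. g \<cdot> f k)"
  using assms(2)
proof (induction I rule: infinite_finite_induct)
  case (insert a I)
  then have "g \<cdot> (f a + (\<Sum>k\<in>I. f k)) = g \<cdot> f a + g \<cdot> (\<Sum>k\<in>I. f k)"
    by (intro comp_add_right[OF _ _ assms(1), of _ X] sum_hom) auto
  with insert show ?case by simp
qed (simp_all add: comp_zero_right[OF assms(1)])

lemma zero_object_iff: "zero_object T Z \<longleftrightarrow> Idn T Z = 0"
proof
  assume "zero_object T Z"
  then show "Idn T Z = 0" using idn_hom unfolding zero_object_def by blast
next
  assume id0: "Idn T Z = 0"
  have "f = 0" if "f \<in> Hom T X Z" for f X
    using comp_idn_left[OF that] comp_zero_left[OF that] id0 by simp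
  moreover have "f = 0" if "f \<in> Hom T Z X" for f X
    using comp_idn_right[OF that] comp_zero_right[OF that] id0 by simp
  ultimately show "zero_object T Z"
    using zero_hom unfolding zero_object_def by blast
qed

lemma is_isoI:
  assumes "f \<in> Hom T X Y" "g \<in> Hom T Y X" "g \<cdot> f = Idn T X" "f \<cdot> g = Idn T Y"
  shows "is_iso T X Y f"
  using assms unfolding is_iso_def by blast

lemma is_iso_idn: "is_iso T X X (Idn T X)"
  using idn_hom by (blast intro: is_isoI comp_idn_left)

lemma isomorphic_refl: "isomorphic T X X"
  using is_iso_idn unfolding isomorphic_def by blast

lemma isomorphic_sym: "isomorphic T X Y \<Longrightarrow> isomorphic T Y X"
  unfolding isomorphic_def is_iso_def by blast

lemma isomorphic_trans:
  assumes "isomorphic T X Y" "isomorphic T Y Z"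
  shows "isomorphic T X Z"
proof -
  obtain f f' where f: "f \<in> Hom T X Y" "f' \<in> Hom T Y X" "f' \<cdot> f = Idn T X" "f \<cdot> f' = Idn T Y"
    using assms(1) unfolding isomorphic_def is_iso_def by blast
  obtain g g' where g: "g \<in> Hom T Y Z" "g' \<in> Hom T Z Y" "g' \<cdot> g = Idn T Y" "g \<cdot> g' = Idn T Z"
    using assms(2) unfolding isomorphic_def is_iso_def by blast
  have "(f' \<cdot> g') \<cdot> (g \<cdot> f) = f' \<cdot> ((g' \<cdot> g) \<cdot> f)"
    using comp_assoc[OF comp_hom[OF f(1) g(1)] g(2) f(2)] comp_assoc[OF f(1) g(1) g(2)] by simp
  then have 1: "(f' \<cdot> g') \<cdot> (g \<cdot> f) = Idn T X"
    using f g comp_idn_left[OF f(1)] by simp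
  have "(g \<cdot> f) \<cdot> (f' \<cdot> g') = g \<cdot> ((f \<cdot> f') \<cdot> g')"
    using comp_assoc[OF comp_hom[OF g(2) f(2)] f(1) g(1)] comp_assoc[OF g(2) f(2) f(1)] by simp
  then have 2: "(g \<cdot> f) \<cdot> (f' \<cdot> g') = Idn T Z"
    using f g comp_idn_left[OF g(2)] by simp
  show ?thesis
    using is_isoI[OF comp_hom[OF f(1) g(1)] comp_hom[OF g(2) f(2)] 1 2]
    unfolding isomorphic_def by blast
qed

lemma iso_class_eq_iff: "iso_class T X = iso_class T Y \<longleftrightarrow> isomorphic T X Y"
  unfolding iso_class_def using isomorphic_refl isomorphic_sym isomorphic_trans by blast


section \<open>Finite direct sums\<close>

text \<open>
  \<open>X\<close> is the direct sum of the family \<open>A\<close> over the finite set \<open>I\<close>, with inclusions \<open>i\<close> and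
  projections \<open>p\<close>. Index sets other than initial segments of the natural numbers make it
  possible to drop a summand without renumbering.
\<close>

definition sum_decomp :: "'i set \<Rightarrow> ('i \<Rightarrow> 'o) \<Rightarrow> 'o \<Rightarrow> ('i \<Rightarrow> 'm) \<Rightarrow> ('i \<Rightarrow> 'm) \<Rightarrow> bool" where
  "sum_decomp I A X i p \<longleftrightarrow> finite I \<and>
     (\<forall>k\<in>I. i k \<in> Hom T (A k) X \<and> p k \<in> Hom T X (A k)) \<and>
     (\<forall>k\<in>I. \<forall>l\<in>I. p k \<cdot> i l = (if k = l then Idn T (A k) else 0)) \<and>
     (\<Sum>k\<in>I. i k \<cdot> p k) = Idn T X"

lemma sum_decompD:
  assumes "sum_decomp I A X i p"
  shows "finite I"
    and "k \<in> I \<Longrightarrow> i k \<in> Hom T (A k) X"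
    and "k \<in> I \<Longrightarrow> p k \<in> Hom T X (A k)"
    and "k \<in> I \<Longrightarrow> p k \<cdot> i k = Idn T (A k)"
    and "\<lbrakk>k \<in> I; l \<in> I; k \<noteq> l\<rbrakk> \<Longrightarrow> p k \<cdot> i l = 0"
    and "(\<Sum>k\<in>I. i k \<cdot> p k) = Idn T X"
  using assms unfolding sum_decomp_def by auto

lemma direct_sum_iff_sum_decomp:
  "direct_sum T As X \<longleftrightarrow> (\<exists>i p. sum_decomp {..<length As} ((!) As) X i p)"
  unfolding direct_sum_def sum_decomp_def by (intro ex_cong1) auto

text \<open>The direct sum of two objects, with inclusions \<open>i\<close>, \<open>j\<close> and projections \<open>p\<close>, \<open>q\<close>.\<close>

definition biproduct :: "'o \<Rightarrow> 'o \<Rightarrow> 'o \<Rightarrow> 'm \<Rightarrow> 'm \<Rightarrow> 'm \<Rightarrow> 'm \<Rightarrow> bool" where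
  "biproduct A B X i j p q \<longleftrightarrow>
     i \<in> Hom T A X \<and> j \<in> Hom T B X \<and> p \<in> Hom T X A \<and> q \<in> Hom T X B \<and>
     p \<cdot> i = Idn T A \<and> q \<cdot> j = Idn T B \<and> p \<cdot> j = 0 \<and> q \<cdot> i = 0 \<and> i \<cdot> p + j \<cdot> q = Idn T X"

lemma biproductD:
  assumes "biproduct A B X i j p q"
  shows "i \<in> Hom T A X" "j \<in> Hom T B X" "p \<in> Hom T X A" "q \<in> Hom T X B"
    "p \<cdot> i = Idn T A" "q \<cdot> j = Idn T B" "p \<cdot> j = 0" "q \<cdot> i = 0" "i \<cdot> p + j \<cdot> q = Idn T X"
  using assms unfolding biproduct_def by auto

lemma all_less_two: "(\<forall>k\<in>{..<2::nat}. P k) \<longleftrightarrow> P 0 \<and> P 1"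
  by (auto simp: less_2_cases_iff)

lemma biproduct_iff_sum_decomp:
  "biproduct A B X (i 0) (i 1) (p 0) (p 1) \<longleftrightarrow> sum_decomp {..<2::nat} ((!) [A, B]) X i p"
  unfolding biproduct_def sum_decomp_def all_less_two
  by (auto simp: numeral_2_eq_2)

lemma direct_sum_iff_biproduct:
  "direct_sum T [A, B] X \<longleftrightarrow> (\<exists>i j p q. biproduct A B X i j p q)"
proof
  assume "direct_sum T [A, B] X"
  then show "\<exists>i j p q. biproduct A B X i j p q"
    unfolding direct_sum_iff_sum_decomp
    using biproduct_iff_sum_decomp[THEN iffD2] by (fastforce simp flip: numeral_2_eq_2)
next
  assume "\<exists>i j p q. biproduct A B X i j p q"
  then obtain i j p q where "biproduct A B X i j p q" by blast
  then have "sum_decomp {..<2::nat} ((!) [A, B]) X ((!) [i, j]) ((!) [p, q])"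
    using biproduct_iff_sum_decomp[of A B X "(!) [i, j]" "(!) [p, q]"] by simp
  then show "direct_sum T [A, B] X"
    unfolding direct_sum_iff_sum_decomp by (auto simp flip: numeral_2_eq_2)
qed

lemma biproduct_swap: "biproduct A B X i j p q \<Longrightarrow> biproduct B A X j i q p"
  unfolding biproduct_def by (auto simp: add.commute)

lemma biproduct_zero_iso:
  assumes "biproduct A Z X i j p q" "zero_object T Z"
  shows "isomorphic T A X"
proof -
  have "j = 0" using biproductD(2)[OF assms(1)] assms(2) unfolding zero_object_def by blast
  then have "i \<cdot> p = Idn T X"
    using biproductD(9)[OF assms(1)] comp_zero_left[OF biproductD(4)[OF assms(1)]] by simp
  then show ?thesis
    using biproductD(1,3,5)[OF assms(1)] unfolding isomorphic_def by (blast intro: is_isoI)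
qed

lemma iso_imp_biproduct:
  assumes "isomorphic T A X" "zero_object T Z"
  shows "direct_sum T [A, Z] X"
proof -
  obtain f g where f: "f \<in> Hom T A X" "g \<in> Hom T X A" "g \<cdot> f = Idn T A" "f \<cdot> g = Idn T X"
    using assms(1) unfolding isomorphic_def is_iso_def by blast
  then have "biproduct A Z X f 0 g 0"
    using assms(2) zero_hom[of Z X] zero_hom[of X Z]
    unfolding biproduct_def zero_object_iff
    by (auto simp: comp_zero_left[of _ A X] comp_zero_right[of _ X A] comp_zero_left[of 0 Z X]
        comp_zero_left[of 0 X Z])
  then show ?thesis unfolding direct_sum_iff_biproduct by blast
qed

text \<open>Any retraction of the inclusion of a summand is the projection of a direct sum
  decomposition with the same second summand, whose inclusion changes. Dually, any section of the
  projection is an inclusion, at the cost of changing the other projection.\<close>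

lemma biproduct_change_retraction:
  assumes D: "biproduct A B X i j p q" and a: "a \<in> Hom T X A" "a \<cdot> i = Idn T A"
  shows "biproduct A B X i (j - i \<cdot> (a \<cdot> j)) a q"
proof -
  note d = biproductD[OF D]
  have aj: "a \<cdot> j \<in> Hom T B A" by (rule comp_hom[OF d(2) a(1)])
  have iaj: "i \<cdot> (a \<cdot> j) \<in> Hom T B X" by (rule comp_hom[OF aj d(1)])
  have "a \<cdot> (i \<cdot> (a \<cdot> j)) = a \<cdot> j"
    using comp_assoc[OF aj d(1) a(1)] a(2) comp_idn_left[OF aj] by simp
  then have 1: "a \<cdot> (j - i \<cdot> (a \<cdot> j)) = 0"
    using comp_diff_right[OF d(2) iaj a(1)] by simp
  have "q \<cdot> (i \<cdot> (a \<cdot> j)) = 0"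
    using comp_assoc[OF aj d(1) d(4)] d(8) comp_zero_left[OF aj] by simp
  then have 2: "q \<cdot> (j - i \<cdot> (a \<cdot> j)) = Idn T B"
    using comp_diff_right[OF d(2) iaj d(4)] d(6) by simp
  have "a = a \<cdot> (i \<cdot> p + j \<cdot> q)" using d(9) comp_idn_right[OF a(1)] by simp
  also have "\<dots> = a \<cdot> (i \<cdot> p) + a \<cdot> (j \<cdot> q)"
    by (rule comp_add_right[OF comp_hom[OF d(3) d(1)] comp_hom[OF d(4) d(2)] a(1)])
  also have "\<dots> = p + (a \<cdot> j) \<cdot> q"
    using comp_assoc[OF d(3) d(1) a(1)] comp_assoc[OF d(4) d(2) a(1)] a(2) comp_idn_left[OF d(3)]
    by simp
  finally have "i \<cdot> a = i \<cdot> p + i \<cdot> ((a \<cdot> j) \<cdot> q)"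
    using comp_add_right[OF d(3) comp_hom[OF d(4) aj] d(1)] by simp
  moreover have "(j - i \<cdot> (a \<cdot> j)) \<cdot> q = j \<cdot> q - i \<cdot> ((a \<cdot> j) \<cdot> q)"
    using comp_diff_left[OF d(4) d(2) iaj] comp_assoc[OF d(4) aj d(1)] by simp
  ultimately have 3: "i \<cdot> a + (j - i \<cdot> (a \<cdot> j)) \<cdot> q = Idn T X"
    using d(9) by (simp add: algebra_simps)
  show ?thesis
    unfolding biproduct_def using d a 1 2 3 diff_hom[OF d(2) iaj] by auto
qed

lemma biproduct_change_section:
  assumes D: "biproduct A B X i j p q" and b: "b \<in> Hom T A X" "p \<cdot> b = Idn T A"
  shows "biproduct A B X b j p (q - (q \<cdot> b) \<cdot> p)"
proof -
  note d = biproductD[OF D]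
  have qb: "q \<cdot> b \<in> Hom T A B" by (rule comp_hom[OF b(1) d(4)])
  have qbp: "(q \<cdot> b) \<cdot> p \<in> Hom T X B" by (rule comp_hom[OF d(3) qb])
  have "((q \<cdot> b) \<cdot> p) \<cdot> b = q \<cdot> b"
    using comp_assoc[OF b(1) d(3) qb] b(2) comp_idn_right[OF qb] by simp
  then have 1: "(q - (q \<cdot> b) \<cdot> p) \<cdot> b = 0"
    using comp_diff_left[OF b(1) d(4) qbp] by simp
  have "((q \<cdot> b) \<cdot> p) \<cdot> j = 0"
    using comp_assoc[OF d(2) d(3) qb] d(7) comp_zero_right[OF qb] by simp
  then have 2: "(q - (q \<cdot> b) \<cdot> p) \<cdot> j = Idn T B"
    using comp_diff_left[OF d(2) d(4) qbp] d(6) by simp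
  have "b = (i \<cdot> p + j \<cdot> q) \<cdot> b" using d(9) comp_idn_left[OF b(1)] by simp
  also have "\<dots> = (i \<cdot> p) \<cdot> b + (j \<cdot> q) \<cdot> b"
    by (rule comp_add_left[OF b(1) comp_hom[OF d(3) d(1)] comp_hom[OF d(4) d(2)]])
  also have "\<dots> = i + j \<cdot> (q \<cdot> b)"
    using comp_assoc[OF b(1) d(3) d(1)] comp_assoc[OF b(1) d(4) d(2)] b(2) comp_idn_right[OF d(1)]
    by simp
  finally have "b \<cdot> p = i \<cdot> p + (j \<cdot> (q \<cdot> b)) \<cdot> p"
    using comp_add_left[OF d(3) d(1) comp_hom[OF qb d(2)]] by simp
  moreover have "j \<cdot> (q - (q \<cdot> b) \<cdot> p) = j \<cdot> q - (j \<cdot> (q \<cdot> b)) \<cdot> p"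
    using comp_diff_right[OF d(4) qbp d(2)] comp_assoc[OF d(3) qb d(2)] by simp
  ultimately have 3: "b \<cdot> p + j \<cdot> (q - (q \<cdot> b) \<cdot> p) = Idn T X"
    using d(9) by (simp add: algebra_simps)
  show ?thesis
    unfolding biproduct_def using d b 1 2 3 diff_hom[OF d(4) qbp] by auto
qed

text \<open>Composition of a row with a column through some of the summands of a direct sum. With the
  projections and inclusions of another direct sum as coefficients it gives the composites of the
  comparison morphisms between a direct sum and a partial one.\<close>

lemma sum_decomp_comp:
  assumes D: "sum_decomp I A Y i p" and "J \<subseteq> I"
    and h: "\<And>k. k \<in> J \<Longrightarrow> g k \<in> Hom T (A k) Z" "\<And>k. k \<in> J \<Longrightarrow> f k \<in> Hom T X (A k)"
  shows "(\<Sum>k\<in>J. g k \<cdot> p k) \<cdot> (\<Sum>k\<in>J. i k \<cdot> f k) = (\<Sum>k\<in>J. g k \<cdot> f k)"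
proof -
  note d = sum_decompD[OF D]
  have J: "k \<in> I" if "k \<in> J" for k using that assms(2) by blast
  have "finite J" using d(1) assms(2) finite_subset by blast
  have "(\<Sum>k\<in>J. g k \<cdot> p k) \<cdot> (\<Sum>l\<in>J. i l \<cdot> f l) = (\<Sum>k\<in>J. (g k \<cdot> p k) \<cdot> (\<Sum>l\<in>J. i l \<cdot> f l))"
    using J d h by (intro comp_sum_left) (auto intro!: sum_hom comp_hom)
  also have "\<dots> = (\<Sum>k\<in>J. g k \<cdot> f k)"
  proof (rule sum.cong[OF refl])
    fix k assume k: "k \<in> J"
    have gp: "g k \<cdot> p k \<in> Hom T Y Z" by (rule comp_hom[OF d(3)[OF J[OF k]] h(1)[OF k]])
    have "(g k \<cdot> p k) \<cdot> (\<Sum>l\<in>J. i l \<cdot> f l) = (\<Sum>l\<in>J. (g k \<cdot> p k) \<cdot> (i l \<cdot> f l))"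
      using J d h by (intro comp_sum_right[OF gp]) (auto intro!: comp_hom)
    also have "\<dots> = (\<Sum>l\<in>J. if l = k then g k \<cdot> f k else 0)"
    proof (rule sum.cong[OF refl])
      fix l assume l: "l \<in> J"
      have "(g k \<cdot> p k) \<cdot> (i l \<cdot> f l) = g k \<cdot> ((p k \<cdot> i l) \<cdot> f l)"
        using comp_assoc[OF comp_hom[OF h(2)[OF l] d(2)[OF J[OF l]]] d(3)[OF J[OF k]] h(1)[OF k]]
          comp_assoc[OF h(2)[OF l] d(2)[OF J[OF l]] d(3)[OF J[OF k]]] by simp
      then show "(g k \<cdot> p k) \<cdot> (i l \<cdot> f l) = (if l = k then g k \<cdot> f k else 0)"
        using d(4)[OF J[OF k]] d(5)[OF J[OF k] J[OF l]] comp_idn_left[OF h(2)[OF l]]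
          comp_zero_left[OF h(2)[OF l]] comp_zero_right[OF h(1)[OF k]] by auto
    qed
    also have "\<dots> = g k \<cdot> f k" using \<open>finite J\<close> k by simp
    finally show "(g k \<cdot> p k) \<cdot> (\<Sum>l\<in>J. i l \<cdot> f l) = g k \<cdot> f k" .
  qed
  finally show ?thesis .
qed

text \<open>Any direct sum of all summands but one is a complement of the remaining one.\<close>

lemma sum_decomp_split:
  assumes D: "sum_decomp I A X i p" and a: "a \<in> I"
    and D': "sum_decomp (I - {a}) A X' i' p'"
  shows "\<exists>s r. biproduct (A a) X' X (i a) s (p a) r"
proof -
  note d = sum_decompD[OF D] and d' = sum_decompD[OF D']
  let ?J = "I - {a}"
  define s where "s = (\<Sum>k\<in>?J. i k \<cdot> p' k)"
  define r where "r = (\<Sum>k\<in>?J. i' k \<cdot> p k)"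
  have s: "s \<in> Hom T X' X" unfolding s_def by (intro sum_hom) (auto intro!: comp_hom[OF d'(3) d(2)])
  have r: "r \<in> Hom T X X'" unfolding r_def by (intro sum_hom) (auto intro!: comp_hom[OF d(3) d'(2)])
  have rs: "r \<cdot> s = Idn T X'"
    unfolding r_def s_def using sum_decomp_comp[OF D, of ?J i' X' p' X'] d' by simp
  have sr: "s \<cdot> r = (\<Sum>k\<in>?J. i k \<cdot> p k)"
    unfolding r_def s_def using sum_decomp_comp[OF D', of ?J i X p X] d by simp
  have "p a \<cdot> s = (\<Sum>k\<in>?J. p a \<cdot> (i k \<cdot> p' k))"
    unfolding s_def
    by (intro comp_sum_right[OF d(3)[OF a]]) (auto intro!: comp_hom[OF d'(3) d(2)])
  also have "\<dots> = 0"
  proof (rule sum.neutral, rule ballI)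
    fix k assume k: "k \<in> ?J"
    then have kI: "k \<in> I" "a \<noteq> k" by auto
    show "p a \<cdot> (i k \<cdot> p' k) = 0"
      using comp_assoc[OF d'(3)[OF k] d(2)[OF kI(1)] d(3)[OF a]] d(5)[OF a kI]
        comp_zero_left[OF d'(3)[OF k]] by simp
  qed
  finally have ps: "p a \<cdot> s = 0" .
  have "r \<cdot> i a = (\<Sum>k\<in>?J. (i' k \<cdot> p k) \<cdot> i a)"
    unfolding r_def
    by (intro comp_sum_left[OF d(2)[OF a]]) (auto intro!: comp_hom[OF d(3) d'(2)])
  also have "\<dots> = 0"
  proof (rule sum.neutral, rule ballI)
    fix k assume k: "k \<in> ?J"
    then have kI: "k \<in> I" "k \<noteq> a" by auto
    show "(i' k \<cdot> p k) \<cdot> i a = 0"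
      using comp_assoc[OF d(2)[OF a] d(3)[OF kI(1)] d'(2)[OF k]] d(5)[OF kI(1) a kI(2)]
        comp_zero_right[OF d'(2)[OF k]] by simp
  qed
  finally have ri: "r \<cdot> i a = 0" .
  have "i a \<cdot> p a + s \<cdot> r = Idn T X"
    unfolding sr d(6)[symmetric] using sum.remove[OF d(1) a, of "\<lambda>k. i k \<cdot> p k"] by simp
  then show ?thesis
    unfolding biproduct_def using d(2-4)[OF a] s r rs ps ri by blast
qed

text \<open>A morphism whose first row vanishes on the second summand of the source maps that summand
  into the second summand of the target.\<close>

lemma diagonal_block:
  assumes A: "biproduct A1 A2 A i1 i2 p1 p2" and B: "biproduct B1 B2 B j1 j2 q1 q2"
    and f: "f \<in> Hom T A B" and u: "u \<in> Hom T A1 B1"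
    and row: "q1 \<cdot> f = u \<cdot> p1"
  shows "f \<cdot> i2 = j2 \<cdot> (q2 \<cdot> (f \<cdot> i2))"
proof -
  note a = biproductD[OF A] and b = biproductD[OF B]
  have fi: "f \<cdot> i2 \<in> Hom T A2 B" by (rule comp_hom[OF a(2) f])
  have "q1 \<cdot> (f \<cdot> i2) = (q1 \<cdot> f) \<cdot> i2" using comp_assoc[OF a(2) f b(3)] by simp
  also have "\<dots> = u \<cdot> (p1 \<cdot> i2)" using comp_assoc[OF a(2) a(3) u] row by simp
  also have "\<dots> = 0" using a(7) comp_zero_right[OF u] by simp
  finally have 0: "q1 \<cdot> (f \<cdot> i2) = 0" .
  have "f \<cdot> i2 = (j1 \<cdot> q1 + j2 \<cdot> q2) \<cdot> (f \<cdot> i2)" using b(9) comp_idn_left[OF fi] by simp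
  also have "\<dots> = (j1 \<cdot> q1) \<cdot> (f \<cdot> i2) + (j2 \<cdot> q2) \<cdot> (f \<cdot> i2)"
    by (rule comp_add_left[OF fi comp_hom[OF b(3) b(1)] comp_hom[OF b(4) b(2)]])
  also have "\<dots> = j2 \<cdot> (q2 \<cdot> (f \<cdot> i2))"
    using comp_assoc[OF fi b(3) b(1)] comp_assoc[OF fi b(4) b(2)] 0 comp_zero_right[OF b(1)] by simp
  finally show ?thesis .
qed

end

context linear_additive_category
begin

lemma sum_decomp_exists:
  assumes "finite I"
  shows "\<exists>X i p. sum_decomp I A X i p"
  using assms
proof (induction I)
  case empty
  obtain Z where "zero_object T Z" using zero_object_exists by blast
  then show ?case unfolding sum_decomp_def zero_object_iff by auto
next
  case (insert a I)
  then obtain Y i p where D: "sum_decomp I A Y i p" by blast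
  note d = sum_decompD[OF D]
  obtain X s t q r where B: "biproduct (A a) Y X s t q r"
    using direct_sum_exists[of "A a" Y] unfolding direct_sum_iff_biproduct by blast
  note b = biproductD[OF B]
  define i' where "i' k = (if k = a then s else t \<cdot> i k)" for k
  define p' where "p' k = (if k = a then q else p k \<cdot> r)" for k
  have i': "i' k \<in> Hom T (A k) X" if "k \<in> insert a I" for k
    using that b d unfolding i'_def by (auto intro: comp_hom)
  have p': "p' k \<in> Hom T X (A k)" if "k \<in> insert a I" for k
    using that b d unfolding p'_def by (auto intro: comp_hom)
  have ii: "p' k \<cdot> i' l = p k \<cdot> i l" if k: "k \<in> I" and l: "l \<in> I" for k l
  proof -
    have "p' k \<cdot> i' l = (p k \<cdot> r) \<cdot> (t \<cdot> i l)"
      using k l insert.hyps unfolding i'_def p'_def by auto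
    also have "\<dots> = p k \<cdot> ((r \<cdot> t) \<cdot> i l)"
      using comp_assoc[OF comp_hom[OF d(2)[OF l] b(2)] b(4) d(3)[OF k]]
        comp_assoc[OF d(2)[OF l] b(2) b(4)] by simp
    finally show ?thesis using b(6) comp_idn_left[OF d(2)[OF l]] by simp
  qed
  have ai: "p' a \<cdot> i' l = 0" if l: "l \<in> I" for l
  proof -
    have "p' a \<cdot> i' l = (q \<cdot> t) \<cdot> i l"
      using l insert.hyps comp_assoc[OF d(2)[OF l] b(2) b(3)] unfolding i'_def p'_def by auto
    then show ?thesis using b(7) comp_zero_left[OF d(2)[OF l]] by simp
  qed
  have ia: "p' k \<cdot> i' a = 0" if k: "k \<in> I" for k
  proof -
    have "p' k \<cdot> i' a = p k \<cdot> (r \<cdot> s)"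
      using k insert.hyps comp_assoc[OF b(1) b(4) d(3)[OF k]] unfolding i'_def p'_def by auto
    then show ?thesis using b(8) comp_zero_right[OF d(3)[OF k]] by simp
  qed
  have aa: "p' a \<cdot> i' a = Idn T (A a)"
    using b(5) unfolding i'_def p'_def by simp
  have "(\<Sum>k\<in>I. i' k \<cdot> p' k) = (\<Sum>k\<in>I. t \<cdot> ((i k \<cdot> p k) \<cdot> r))"
  proof (rule sum.cong[OF refl])
    fix k assume k: "k \<in> I"
    have "i' k \<cdot> p' k = (t \<cdot> i k) \<cdot> (p k \<cdot> r)"
      using k insert.hyps unfolding i'_def p'_def by auto
    also have "\<dots> = t \<cdot> ((i k \<cdot> p k) \<cdot> r)"
      using comp_assoc[OF comp_hom[OF b(4) d(3)[OF k]] d(2)[OF k] b(2)]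
        comp_assoc[OF b(4) d(3)[OF k] d(2)[OF k]] by simp
    finally show "i' k \<cdot> p' k = t \<cdot> ((i k \<cdot> p k) \<cdot> r)" .
  qed
  also have "\<dots> = t \<cdot> (\<Sum>k\<in>I. (i k \<cdot> p k) \<cdot> r)"
    using d b by (intro comp_sum_right[symmetric]) (auto intro: comp_hom)
  also have "(\<Sum>k\<in>I. (i k \<cdot> p k) \<cdot> r) = (\<Sum>k\<in>I. i k \<cdot> p k) \<cdot> r"
    using d b by (intro comp_sum_left[symmetric]) (auto intro: comp_hom)
  also have "\<dots> = r" using d(6) comp_idn_left[OF b(4)] by simp
  finally have "(\<Sum>k\<in>insert a I. i' k \<cdot> p' k) = Idn T X"
    using insert.hyps b(9) unfolding i'_def p'_def by simp
  then have "sum_decomp (insert a I) A X i' p'"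
    unfolding sum_decomp_def using i' p' ii ai ia aa d(1,4,5) insert.hyps by auto
  then show ?case by blast
qed

end


section \<open>Triangles\<close>

context linear_triangulated_category
begin

lemma susp_hom: "f \<in> Hom T X Y \<Longrightarrow> SuspM T f \<in> Hom T (Susp T X) (Susp T Y)"
  using susp_fully_faithful bij_betwE by blast

lemma susp_zero: "SuspM T 0 = 0"
  using susp_add[OF zero_hom zero_hom] by fastforce

lemma susp_sum:
  assumes "\<And>k. k \<in> I \<Longrightarrow> f k \<in> Hom T X Y"
  shows "SuspM T (\<Sum>k\<in>I. f k) = (\<Sum>k\<in>I. SuspM T (f k))"
  using assms
proof (induction I rule: infinite_finite_induct)
  case (insert a I)
  then have "SuspM T (f a + (\<Sum>k\<in>I. f k)) = SuspM T (f a) + SuspM T (\<Sum>k\<in>I. f k)"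
    by (intro susp_add[of _ X Y] sum_hom) auto
  with insert show ?case by simp
qed (simp_all add: susp_zero)

lemma susp_zero_object: "zero_object T Z \<Longrightarrow> zero_object T (Susp T Z)"
  using susp_idn susp_zero unfolding zero_object_iff by metis

lemma dist_rotate: "Dist T X Y Z f g h \<Longrightarrow> Dist T Y Z (Susp T X) g h (- SuspM T f)"
  using dist_hom TR2 by blast

text \<open>The triangles on \<open>0 \<rightarrow> X\<close> and \<open>X \<rightarrow> 0\<close>.\<close>

lemma dist_zero_source:
  assumes "zero_object T Z"
  shows "Dist T Z X X 0 (Idn T X) 0"
proof -
  have "Dist T X X (Susp T Z) (Idn T X) 0 (- SuspM T 0)"
    using TR1_idn[OF susp_zero_object[OF assms]] susp_zero by simp
  then show ?thesis using TR2 zero_hom idn_hom by blast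
qed

lemma dist_zero_target:
  assumes "zero_object T Z"
  shows "\<exists>h. Dist T X Z (Susp T X) 0 0 h"
  using dist_rotate[OF TR1_idn[OF assms]] by blast

text \<open>The second morphism of a triangle is a weak cokernel of the first.\<close>

lemma dist_factor:
  assumes D: "Dist T X Y Z f g h" and t: "t \<in> Hom T Y W" "t \<cdot> f = 0"
  shows "\<exists>s\<in>Hom T Z W. t = s \<cdot> g"
proof -
  note d = dist_hom[OF D]
  obtain Z0 where Z0: "zero_object T Z0" using zero_object_exists by blast
  have "0 \<cdot> (0::'m) = 0" using comp_zero_left[OF zero_hom] .
  then obtain c where "c \<in> Hom T Z W" "c \<cdot> g = Idn T W \<cdot> t"
    using TR3[OF D dist_zero_source[OF Z0] zero_hom[of X Z0] t(1)] t(2)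
      comp_zero_left[OF zero_hom[of X Z0]] by auto
  then show ?thesis using comp_idn_left[OF t(1)] by metis
qed

text \<open>The morphism \<open>n\<close> factors through the connecting morphism \<open>h\<close>, which kills \<open>m\<close>.\<close>

lemma dist_comp_vanishes:
  assumes D: "Dist T X Y Z f g h"
    and n: "n \<in> Hom T Z W" "n \<cdot> g = 0" and m: "m \<in> Hom T V Z" "h \<cdot> m = 0"
  shows "n \<cdot> m = 0"
proof -
  obtain s where s: "s \<in> Hom T (Susp T X) W" "n = s \<cdot> h"
    using dist_factor[OF dist_rotate[OF D] n] by blast
  have h: "h \<in> Hom T Z (Susp T X)" using dist_hom[OF D] by blast
  show ?thesis using comp_assoc[OF m(1) h s(1)] m(2) s(2) comp_zero_right[OF s(1)] by simp
qed

text \<open>An endomorphism of the cone that is compatible with the identities of the other two objects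
  is the sum of the identity and an endomorphism of square zero. Hence it is invertible, and the
  inverse is again compatible with these identities. This replaces the five lemma.\<close>

lemma dist_unipotent:
  assumes D: "Dist T X Y Z f g h"
    and e: "e \<in> Hom T Z Z" "e \<cdot> g = g" "h \<cdot> e = h"
  shows "\<exists>e'\<in>Hom T Z Z. e \<cdot> e' = Idn T Z \<and> e' \<cdot> e = Idn T Z \<and> e' \<cdot> g = g \<and> h \<cdot> e' = h"
proof -
  have d: "g \<in> Hom T Y Z" "h \<in> Hom T Z (Susp T X)" using dist_hom[OF D] by blast+
  define n where "n = e - Idn T Z"
  have n: "n \<in> Hom T Z Z" unfolding n_def by (rule diff_hom[OF e(1) idn_hom])
  have ng: "n \<cdot> g = 0"
    unfolding n_def using comp_diff_left[OF d(1) e(1) idn_hom] comp_idn_left[OF d(1)] e(2) by simp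
  have hn: "h \<cdot> n = 0"
    unfolding n_def using comp_diff_right[OF e(1) idn_hom d(2)] comp_idn_right[OF d(2)] e(3) by simp
  have nn: "n \<cdot> n = 0" by (rule dist_comp_vanishes[OF D n ng n hn])
  have en: "e = Idn T Z + n" unfolding n_def by simp
  \<comment> \<open>The inverse of \<open>1 + n\<close> for \<open>n\<close> of square zero.\<close>
  define e' where "e' = Idn T Z - n"
  have e': "e' \<in> Hom T Z Z" unfolding e'_def by (rule diff_hom[OF idn_hom n])
  have "e \<cdot> n = n"
    unfolding en using comp_add_left[OF n idn_hom n] comp_idn_left[OF n] nn by simp
  then have 1: "e \<cdot> e' = Idn T Z"
    unfolding e'_def using comp_diff_right[OF idn_hom n e(1)] comp_idn_right[OF e(1)] n_def by simp
  have "n \<cdot> e = n"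
    unfolding en using comp_add_right[OF idn_hom n n] comp_idn_right[OF n] nn by simp
  then have 2: "e' \<cdot> e = Idn T Z"
    unfolding e'_def using comp_diff_left[OF e(1) idn_hom n] comp_idn_left[OF e(1)] n_def by simp
  have 3: "e' \<cdot> g = g"
    unfolding e'_def using comp_diff_left[OF d(1) idn_hom n] comp_idn_left[OF d(1)] ng by simp
  have 4: "h \<cdot> e' = h"
    unfolding e'_def using comp_diff_right[OF idn_hom n d(2)] comp_idn_right[OF d(2)] hn by simp
  show ?thesis using e' 1 2 3 4 by blast
qed

text \<open>Isomorphic morphisms have isomorphic cones: both composites of the induced morphisms between
  the cones are unipotent.\<close>

lemma cones_isomorphic:
  assumes D: "Dist T X Y Z f g h" and D': "Dist T X' Y' Z' f' g' h'"
    and a: "is_iso T X X' a" and b: "is_iso T Y Y' b" and comm: "b \<cdot> f = f' \<cdot> a"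
  shows "isomorphic T Z Z'"
proof -
  have d: "f \<in> Hom T X Y" "g \<in> Hom T Y Z" "h \<in> Hom T Z (Susp T X)" using dist_hom[OF D] by blast+
  have d': "f' \<in> Hom T X' Y'" "g' \<in> Hom T Y' Z'" "h' \<in> Hom T Z' (Susp T X')"
    using dist_hom[OF D'] by blast+
  obtain a' where a': "a \<in> Hom T X X'" "a' \<in> Hom T X' X" "a' \<cdot> a = Idn T X" "a \<cdot> a' = Idn T X'"
    using a unfolding is_iso_def by blast
  obtain b' where b': "b \<in> Hom T Y Y'" "b' \<in> Hom T Y' Y" "b' \<cdot> b = Idn T Y" "b \<cdot> b' = Idn T Y'"
    using b unfolding is_iso_def by blast
  have "b' \<cdot> f' = b' \<cdot> ((f' \<cdot> a) \<cdot> a')"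
    using comp_assoc[OF a'(2,1) d'(1)] a'(4) comp_idn_right[OF d'(1)] by simp
  also have "\<dots> = b' \<cdot> (b \<cdot> (f \<cdot> a'))" using comm comp_assoc[OF a'(2) d(1) b'(1)] by simp
  also have "\<dots> = f \<cdot> a'"
    using comp_assoc[OF comp_hom[OF a'(2) d(1)] b'(1,2)] b'(3) comp_idn_left[OF comp_hom[OF a'(2) d(1)]]
    by simp
  finally have comm': "b' \<cdot> f' = f \<cdot> a'" .
  obtain c where c: "c \<in> Hom T Z Z'" "c \<cdot> g = g' \<cdot> b" "SuspM T a \<cdot> h = h' \<cdot> c"
    using TR3[OF D D' a'(1) b'(1) comm] by blast
  obtain c' where c': "c' \<in> Hom T Z' Z" "c' \<cdot> g' = g \<cdot> b'" "SuspM T a' \<cdot> h' = h \<cdot> c'"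
    using TR3[OF D' D a'(2) b'(2) comm'] by blast
  have inv: "SuspM T a' \<cdot> SuspM T a = Idn T (Susp T X)" "SuspM T a \<cdot> SuspM T a' = Idn T (Susp T X')"
    using susp_comp[OF a'(1,2)] susp_comp[OF a'(2,1)] a'(3,4) susp_idn by simp_all
  have "(c' \<cdot> c) \<cdot> g = (c' \<cdot> g') \<cdot> b"
    using comp_assoc[OF d(2) c(1) c'(1)] comp_assoc[OF b'(1) d'(2) c'(1)] c(2) by simp
  also have "\<dots> = g" using comp_assoc[OF b'(1,2) d(2)] c'(2) b'(3) comp_idn_right[OF d(2)] by simp
  finally have 1: "(c' \<cdot> c) \<cdot> g = g" .
  have "h \<cdot> (c' \<cdot> c) = SuspM T a' \<cdot> (h' \<cdot> c)"
    using comp_assoc[OF c(1) c'(1) d(3)] comp_assoc[OF c(1) d'(3) susp_hom[OF a'(2)]] c'(3) by simp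
  also have "\<dots> = h"
    using comp_assoc[OF d(3) susp_hom[OF a'(1)] susp_hom[OF a'(2)]] c(3) inv comp_idn_left[OF d(3)]
    by simp
  finally have 2: "h \<cdot> (c' \<cdot> c) = h" .
  have "(c \<cdot> c') \<cdot> g' = (c \<cdot> g) \<cdot> b'"
    using comp_assoc[OF d'(2) c'(1) c(1)] comp_assoc[OF b'(2) d(2) c(1)] c'(2) by simp
  also have "\<dots> = g'" using comp_assoc[OF b'(2,1) d'(2)] c(2) b'(4) comp_idn_right[OF d'(2)] by simp
  finally have 3: "(c \<cdot> c') \<cdot> g' = g'" .
  have "h' \<cdot> (c \<cdot> c') = SuspM T a \<cdot> (h \<cdot> c')"
    using comp_assoc[OF c'(1) c(1) d'(3)] comp_assoc[OF c'(1) d(3) susp_hom[OF a'(1)]] c(3) by simp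
  also have "\<dots> = h'"
    using comp_assoc[OF d'(3) susp_hom[OF a'(2)] susp_hom[OF a'(1)]] c'(3) inv comp_idn_left[OF d'(3)]
    by simp
  finally have 4: "h' \<cdot> (c \<cdot> c') = h'" .
  have cc: "c' \<cdot> c \<in> Hom T Z Z" "c \<cdot> c' \<in> Hom T Z' Z'"
    using comp_hom[OF c(1) c'(1)] comp_hom[OF c'(1) c(1)] .
  obtain r where r: "r \<in> Hom T Z Z" "r \<cdot> (c' \<cdot> c) = Idn T Z"
    using dist_unipotent[OF D cc(1) 1 2] by blast
  obtain s where s: "s \<in> Hom T Z' Z'" "(c \<cdot> c') \<cdot> s = Idn T Z'"
    using dist_unipotent[OF D' cc(2) 3 4] by blast
  define l where "l = r \<cdot> c'"
  define m where "m = c' \<cdot> s"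
  have lm: "l \<in> Hom T Z' Z" "m \<in> Hom T Z' Z"
    unfolding l_def m_def using comp_hom[OF c'(1) r(1)] comp_hom[OF s(1) c'(1)] .
  have l: "l \<cdot> c = Idn T Z" unfolding l_def using comp_assoc[OF c(1) c'(1) r(1)] r(2) by simp
  have m: "c \<cdot> m = Idn T Z'" unfolding m_def using comp_assoc[OF s(1) c'(1) c(1)] s(2) by simp
  have "l = l \<cdot> (c \<cdot> m)" using m comp_idn_right[OF lm(1)] by simp
  also have "\<dots> = m" using comp_assoc[OF lm(2) c(1) lm(1)] l comp_idn_left[OF lm(2)] by simp
  finally show ?thesis
    using is_isoI[OF c(1) lm(1) l] m unfolding isomorphic_def by blast
qed

lemma dist_iso_cone:
  assumes D: "Dist T X Y Z f g h" and "isomorphic T Z Z'"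
  shows "\<exists>g' h'. Dist T X Y Z' f g' h'"
proof -
  have d: "f \<in> Hom T X Y" "g \<in> Hom T Y Z" "h \<in> Hom T Z (Susp T X)" using dist_hom[OF D] by blast+
  obtain r where r: "is_iso T Z Z' r" using assms(2) unfolding isomorphic_def by blast
  then obtain s where s: "r \<in> Hom T Z Z'" "s \<in> Hom T Z' Z" "s \<cdot> r = Idn T Z"
    unfolding is_iso_def by blast
  have "Dist T X Y Z' f (r \<cdot> g) (h \<cdot> s)"
  proof (rule dist_iso[OF D d(1) _ _ is_iso_idn is_iso_idn r])
    show "r \<cdot> g \<in> Hom T Y Z'" "h \<cdot> s \<in> Hom T Z' (Susp T X)"
      using comp_hom[OF d(2) s(1)] comp_hom[OF s(2) d(3)] .
    show "Idn T Y \<cdot> f = f \<cdot> Idn T X" using comp_idn_left[OF d(1)] comp_idn_right[OF d(1)] by simp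
    show "r \<cdot> g = (r \<cdot> g) \<cdot> Idn T Y" using comp_idn_right[OF comp_hom[OF d(2) s(1)]] by simp
    show "SuspM T (Idn T X) \<cdot> h = (h \<cdot> s) \<cdot> r"
      using comp_assoc[OF s(1,2) d(3)] s(3) comp_idn_right[OF d(3)] comp_idn_left[OF d(3)] susp_idn
      by simp
  qed
  then show ?thesis by blast
qed

lemma cone_of_iso_zero:
  assumes D: "Dist T X Y Z f g h" and f: "is_iso T X Y f"
  shows "zero_object T Z"
proof -
  obtain Z0 where Z0: "zero_object T Z0" using zero_object_exists by blast
  have fXY: "f \<in> Hom T X Y" using f unfolding is_iso_def by blast
  have "isomorphic T Z0 Z"
    using cones_isomorphic[OF TR1_idn[OF Z0, of X] D is_iso_idn f refl] .
  then obtain r s where "r \<in> Hom T Z0 Z" "s \<in> Hom T Z Z0" "r \<cdot> s = Idn T Z"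
    unfolding isomorphic_def is_iso_def by blast
  moreover from this have "r = 0" using Z0 unfolding zero_object_def by blast
  ultimately show ?thesis using comp_zero_left unfolding zero_object_iff by metis
qed

text \<open>
  The cone of a direct sum of morphisms is the direct sum of the cones. Extending the inclusions
  and the projections to morphisms \<open>c\<close> and \<open>d\<close> of triangles, the sum of the \<open>c k \<cdot> d k\<close> is
  unipotent, so that \<open>d\<close> can be corrected to make it the identity. Then the matrix of the
  \<open>d l \<cdot> c k\<close> is an idempotent, whose difference \<open>N\<close> to the identity matrix squares to zero by
  \<open>dist_comp_vanishes\<close>. Hence \<open>N = 0\<close>.
\<close>

lemma sum_decomp_cone:
  assumes DA: "sum_decomp I A A0 i p" and DB: "sum_decomp I B B0 j q"
    and D0: "Dist T A0 B0 X0 f g h"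
    and D: "\<And>k. k \<in> I \<Longrightarrow> Dist T (A k) (B k) (X k) (u k) (v k) (w k)"
    and fi: "\<And>k. k \<in> I \<Longrightarrow> f \<cdot> i k = j k \<cdot> u k"
  shows "\<exists>c d. sum_decomp I X X0 c d"
proof -
  note a = sum_decompD[OF DA] and b = sum_decompD[OF DB]
  have d0: "f \<in> Hom T A0 B0" "g \<in> Hom T B0 X0" "h \<in> Hom T X0 (Susp T A0)"
    using dist_hom[OF D0] by blast+
  have u: "u k \<in> Hom T (A k) (B k)" and v: "v k \<in> Hom T (B k) (X k)"
    and w: "w k \<in> Hom T (X k) (Susp T (A k))" if "k \<in> I" for k
    using dist_hom[OF D[OF that]] by blast+
  have qf: "q k \<cdot> f = u k \<cdot> p k" if k: "k \<in> I" for k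
  proof -
    have qk: "q k \<cdot> f \<in> Hom T A0 (B k)" by (rule comp_hom[OF d0(1) b(3)[OF k]])
    have "q k \<cdot> f = (q k \<cdot> f) \<cdot> (\<Sum>l\<in>I. i l \<cdot> p l)" using a(6) comp_idn_right[OF qk] by simp
    also have "\<dots> = (\<Sum>l\<in>I. (q k \<cdot> f) \<cdot> (i l \<cdot> p l))"
      by (rule comp_sum_right[OF qk]) (rule comp_hom[OF a(3) a(2)])
    also have "\<dots> = (\<Sum>l\<in>I. if l = k then u k \<cdot> p k else 0)"
    proof (rule sum.cong[OF refl])
      fix l assume l: "l \<in> I"
      have "(q k \<cdot> f) \<cdot> (i l \<cdot> p l) = (q k \<cdot> (f \<cdot> i l)) \<cdot> p l"
        using comp_assoc[OF a(3)[OF l] a(2)[OF l] qk] comp_assoc[OF a(2)[OF l] d0(1) b(3)[OF k]]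
        by simp
      also have "\<dots> = ((q k \<cdot> j l) \<cdot> u l) \<cdot> p l"
        using fi[OF l] comp_assoc[OF u[OF l] b(2)[OF l] b(3)[OF k]] by simp
      finally show "(q k \<cdot> f) \<cdot> (i l \<cdot> p l) = (if l = k then u k \<cdot> p k else 0)"
        using b(4)[OF k] b(5)[OF k l] comp_idn_left[OF u[OF l]] comp_zero_left[OF u[OF l]]
          comp_zero_left[OF a(3)[OF l]] by auto
    qed
    finally show ?thesis using a(1) k by simp
  qed
  have "\<forall>k\<in>I. \<exists>c. c \<in> Hom T (X k) X0 \<and> c \<cdot> v k = g \<cdot> j k \<and> SuspM T (i k) \<cdot> w k = h \<cdot> c"
    using TR3[OF D D0 a(2) b(2)] fi by (metis (no_types))
  then obtain c where c: "\<And>k. k \<in> I \<Longrightarrow> c k \<in> Hom T (X k) X0"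
    and cv: "\<And>k. k \<in> I \<Longrightarrow> c k \<cdot> v k = g \<cdot> j k"
    and hc: "\<And>k. k \<in> I \<Longrightarrow> SuspM T (i k) \<cdot> w k = h \<cdot> c k" by metis
  have "\<forall>k\<in>I. \<exists>d. d \<in> Hom T X0 (X k) \<and> d \<cdot> g = v k \<cdot> q k \<and> SuspM T (p k) \<cdot> h = w k \<cdot> d"
    using TR3[OF D0 D a(3) b(3)] qf by (metis (no_types))
  then obtain d' where d': "\<And>k. k \<in> I \<Longrightarrow> d' k \<in> Hom T X0 (X k)"
    and d'g: "\<And>k. k \<in> I \<Longrightarrow> d' k \<cdot> g = v k \<cdot> q k"
    and wd': "\<And>k. k \<in> I \<Longrightarrow> SuspM T (p k) \<cdot> h = w k \<cdot> d' k" by metis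
  define e where "e = (\<Sum>k\<in>I. c k \<cdot> d' k)"
  have e: "e \<in> Hom T X0 X0" unfolding e_def by (rule sum_hom) (rule comp_hom[OF d' c])
  have "e \<cdot> g = (\<Sum>k\<in>I. (c k \<cdot> d' k) \<cdot> g)"
    unfolding e_def by (rule comp_sum_left[OF d0(2)]) (rule comp_hom[OF d' c])
  also have "\<dots> = (\<Sum>k\<in>I. g \<cdot> (j k \<cdot> q k))"
  proof (rule sum.cong[OF refl])
    fix k assume k: "k \<in> I"
    show "(c k \<cdot> d' k) \<cdot> g = g \<cdot> (j k \<cdot> q k)"
      using comp_assoc[OF d0(2) d'[OF k] c[OF k]] d'g[OF k] comp_assoc[OF b(3)[OF k] v[OF k] c[OF k]]
        cv[OF k] comp_assoc[OF b(3)[OF k] b(2)[OF k] d0(2)] by simp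
  qed
  also have "\<dots> = g \<cdot> (\<Sum>k\<in>I. j k \<cdot> q k)"
    by (rule comp_sum_right[OF d0(2), symmetric]) (rule comp_hom[OF b(3) b(2)])
  finally have eg: "e \<cdot> g = g" using b(6) comp_idn_right[OF d0(2)] by simp
  have "h \<cdot> e = (\<Sum>k\<in>I. h \<cdot> (c k \<cdot> d' k))"
    unfolding e_def by (rule comp_sum_right[OF d0(3)]) (rule comp_hom[OF d' c])
  also have "\<dots> = (\<Sum>k\<in>I. SuspM T (i k \<cdot> p k) \<cdot> h)"
  proof (rule sum.cong[OF refl])
    fix k assume k: "k \<in> I"
    have "h \<cdot> (c k \<cdot> d' k) = (SuspM T (i k) \<cdot> w k) \<cdot> d' k"
      using comp_assoc[OF d'[OF k] c[OF k] d0(3)] hc[OF k] by simp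
    also have "\<dots> = SuspM T (i k) \<cdot> (SuspM T (p k) \<cdot> h)"
      using comp_assoc[OF d'[OF k] w[OF k] susp_hom[OF a(2)[OF k]]] wd'[OF k] by simp
    also have "\<dots> = SuspM T (i k \<cdot> p k) \<cdot> h"
      using comp_assoc[OF d0(3) susp_hom[OF a(3)[OF k]] susp_hom[OF a(2)[OF k]]]
        susp_comp[OF a(3)[OF k] a(2)[OF k]] by simp
    finally show "h \<cdot> (c k \<cdot> d' k) = SuspM T (i k \<cdot> p k) \<cdot> h" .
  qed
  also have "\<dots> = (\<Sum>k\<in>I. SuspM T (i k \<cdot> p k)) \<cdot> h"
    by (rule comp_sum_left[OF d0(3), symmetric]) (rule susp_hom[OF comp_hom[OF a(3) a(2)]])
  also have "(\<Sum>k\<in>I. SuspM T (i k \<cdot> p k)) = SuspM T (\<Sum>k\<in>I. i k \<cdot> p k)"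
    by (rule susp_sum[symmetric]) (rule comp_hom[OF a(3) a(2)])
  finally have he: "h \<cdot> e = h" using a(6) susp_idn comp_idn_left[OF d0(3)] by simp
  obtain e' where e': "e' \<in> Hom T X0 X0" "e \<cdot> e' = Idn T X0" "e' \<cdot> g = g" "h \<cdot> e' = h"
    using dist_unipotent[OF D0 e eg he] by blast
  define d where "d k = d' k \<cdot> e'" for k
  have d: "d k \<in> Hom T X0 (X k)" if "k \<in> I" for k
    unfolding d_def by (rule comp_hom[OF e'(1) d'[OF that]])
  have dg: "d k \<cdot> g = v k \<cdot> q k" if "k \<in> I" for k
    unfolding d_def using comp_assoc[OF d0(2) e'(1) d'[OF that]] e'(3) d'g[OF that] by simp
  have wd: "w k \<cdot> d k = SuspM T (p k) \<cdot> h" if "k \<in> I" for k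
    unfolding d_def
    using comp_assoc[OF e'(1) d'[OF that] w[OF that]] wd'[OF that]
      comp_assoc[OF e'(1) d0(3) susp_hom[OF a(3)[OF that]]] e'(4) by simp
  have "(\<Sum>k\<in>I. c k \<cdot> d k) = (\<Sum>k\<in>I. (c k \<cdot> d' k) \<cdot> e')"
    unfolding d_def using comp_assoc[OF e'(1) d' c] by (intro sum.cong refl) simp
  also have "\<dots> = e \<cdot> e'"
    unfolding e_def by (rule comp_sum_left[OF e'(1), symmetric]) (rule comp_hom[OF d' c])
  finally have cd: "(\<Sum>k\<in>I. c k \<cdot> d k) = Idn T X0" using e'(2) by simp
  define M where "M l k = d l \<cdot> c k" for l k
  define E where "E l k = (if l = k then Idn T (X k) else 0)" for l k
  define N where "N l k = M l k - E l k" for l k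
  have M: "M l k \<in> Hom T (X k) (X l)" if "k \<in> I" "l \<in> I" for k l
    unfolding M_def by (rule comp_hom[OF c[OF that(1)] d[OF that(2)]])
  have E: "E l k \<in> Hom T (X k) (X l)" for k l unfolding E_def using idn_hom zero_hom by auto
  have N: "N l k \<in> Hom T (X k) (X l)" if "k \<in> I" "l \<in> I" for k l
    unfolding N_def by (rule diff_hom[OF M[OF that] E])
  have Nv: "N l k \<cdot> v k = 0" if k: "k \<in> I" and l: "l \<in> I" for k l
  proof -
    have "M l k \<cdot> v k = v l \<cdot> (q l \<cdot> j k)"
      unfolding M_def
      using comp_assoc[OF v[OF k] c[OF k] d[OF l]] cv[OF k] comp_assoc[OF b(2)[OF k] d0(2) d[OF l]]
        dg[OF l] comp_assoc[OF b(2)[OF k] b(3)[OF l] v[OF l]] by simp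
    also have "\<dots> = E l k \<cdot> v k"
      unfolding E_def
      using b(4)[OF k] b(5)[OF l k] comp_idn_left[OF v[OF k]] comp_idn_right[OF v[OF k]]
        comp_zero_left[OF v[OF k]] comp_zero_right[OF v[OF l]] by auto
    finally show ?thesis unfolding N_def using comp_diff_left[OF v[OF k] M[OF k l] E] by simp
  qed
  have wN: "w l \<cdot> N l k = 0" if k: "k \<in> I" and l: "l \<in> I" for k l
  proof -
    have "w l \<cdot> M l k = SuspM T (p l) \<cdot> (h \<cdot> c k)"
      unfolding M_def using comp_assoc[OF c[OF k] d[OF l] w[OF l]] wd[OF l]
        comp_assoc[OF c[OF k] d0(3) susp_hom[OF a(3)[OF l]]] by simp
    also have "\<dots> = SuspM T (p l \<cdot> i k) \<cdot> w k"
      using hc[OF k] comp_assoc[OF w[OF k] susp_hom[OF a(2)[OF k]] susp_hom[OF a(3)[OF l]]]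
        susp_comp[OF a(2)[OF k] a(3)[OF l]] by simp
    also have "\<dots> = w l \<cdot> E l k"
      unfolding E_def
      using a(4)[OF k] a(5)[OF l k] susp_idn susp_zero comp_idn_left[OF w[OF k]]
        comp_idn_right[OF w[OF k]] comp_zero_left[OF w[OF k]] comp_zero_right[OF w[OF l]] by auto
    finally show ?thesis unfolding N_def using comp_diff_right[OF M[OF k l] E w[OF l]] by simp
  qed
  have dc: "d l \<cdot> c k = E l k" if k: "k \<in> I" and l: "l \<in> I" for k l
  proof -
    have MM: "(\<Sum>m\<in>I. M l m \<cdot> M m k) = M l k"
    proof -
      have "(\<Sum>m\<in>I. M l m \<cdot> M m k) = (\<Sum>m\<in>I. (d l \<cdot> (c m \<cdot> d m)) \<cdot> c k)"
      proof (rule sum.cong[OF refl])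
        fix m assume m: "m \<in> I"
        show "M l m \<cdot> M m k = (d l \<cdot> (c m \<cdot> d m)) \<cdot> c k"
          unfolding M_def
          using comp_assoc[OF c[OF k] d[OF m] comp_hom[OF c[OF m] d[OF l]]]
            comp_assoc[OF d[OF m] c[OF m] d[OF l]] by simp
      qed
      also have "\<dots> = (\<Sum>m\<in>I. d l \<cdot> (c m \<cdot> d m)) \<cdot> c k"
        by (rule comp_sum_left[OF c[OF k], symmetric]) (rule comp_hom[OF comp_hom[OF d c] d[OF l]])
      also have "(\<Sum>m\<in>I. d l \<cdot> (c m \<cdot> d m)) = d l \<cdot> (\<Sum>m\<in>I. c m \<cdot> d m)"
        by (rule comp_sum_right[OF d[OF l], symmetric]) (rule comp_hom[OF d c])
      finally show ?thesis unfolding M_def using cd comp_idn_right[OF d[OF l]] by simp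
    qed
    have EM: "(\<Sum>m\<in>I. E l m \<cdot> M m k) = M l k"
    proof -
      have "E l m \<cdot> M m k = (if m = l then M l k else 0)" if "m \<in> I" for m
        unfolding E_def using comp_idn_left[OF M[OF k that]] comp_zero_left[OF M[OF k that]] by auto
      then show ?thesis using a(1) l by simp
    qed
    have ME: "(\<Sum>m\<in>I. N l m \<cdot> E m k) = N l k"
    proof -
      have "N l m \<cdot> E m k = (if m = k then N l k else 0)" if "m \<in> I" for m
        unfolding E_def using comp_idn_right[OF N[OF that l]] comp_zero_right[OF N[OF that l]] by auto
      then show ?thesis using a(1) k by simp
    qed
    \<comment> \<open>For \<open>M\<close> idempotent, the square of \<open>N = M - 1\<close> is \<open>M - M - N = - N\<close>.\<close>
    have "0 = (\<Sum>m\<in>I. N l m \<cdot> N m k)"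
      using dist_comp_vanishes[OF D N[OF _ l] Nv[OF _ l] N[OF k] wN[OF k]] by simp
    also have "\<dots> = (\<Sum>m\<in>I. M l m \<cdot> M m k - E l m \<cdot> M m k - N l m \<cdot> E m k)"
    proof (rule sum.cong[OF refl])
      fix m assume m: "m \<in> I"
      have "N l m \<cdot> N m k = N l m \<cdot> M m k - N l m \<cdot> E m k"
        unfolding N_def[of m k] by (rule comp_diff_right[OF M[OF k m] E N[OF m l]])
      moreover have "N l m \<cdot> M m k = M l m \<cdot> M m k - E l m \<cdot> M m k"
        unfolding N_def by (rule comp_diff_left[OF M[OF k m] M[OF m l] E])
      ultimately show "N l m \<cdot> N m k = M l m \<cdot> M m k - E l m \<cdot> M m k - N l m \<cdot> E m k" by simp
    qed
    also have "\<dots> = - N l k" unfolding sum_subtractf MM EM ME by simp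
    finally show ?thesis unfolding N_def M_def by simp
  qed
  have "sum_decomp I X X0 c d"
    unfolding sum_decomp_def using a(1) c d dc cd by (auto simp: E_def)
  then show ?thesis by blast
qed

lemma direct_sum_cone:
  assumes A: "biproduct A1 A2 A i1 i2 p1 p2" and B: "biproduct B1 B2 B j1 j2 q1 q2"
    and D: "Dist T A B X f g h" and D1: "Dist T A1 B1 X1 u1 v1 w1" and D2: "Dist T A2 B2 X2 u2 v2 w2"
    and fi: "f \<cdot> i1 = j1 \<cdot> u1" "f \<cdot> i2 = j2 \<cdot> u2"
  shows "direct_sum T [X1, X2] X"
proof -
  have "\<exists>c d. sum_decomp {..<2::nat} ((!) [X1, X2]) X c d"
  proof (rule sum_decomp_cone[OF _ _ D])
    show "sum_decomp {..<2::nat} ((!) [A1, A2]) A ((!) [i1, i2]) ((!) [p1, p2])"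
      using A biproduct_iff_sum_decomp[of A1 A2 A "(!) [i1, i2]" "(!) [p1, p2]"] by simp
    show "sum_decomp {..<2::nat} ((!) [B1, B2]) B ((!) [j1, j2]) ((!) [q1, q2])"
      using B biproduct_iff_sum_decomp[of B1 B2 B "(!) [j1, j2]" "(!) [q1, q2]"] by simp
    fix k :: nat assume "k \<in> {..<2}"
    then have k: "k = 0 \<or> k = 1" by auto
    then show "Dist T ([A1, A2] ! k) ([B1, B2] ! k) ([X1, X2] ! k) ([u1, u2] ! k) ([v1, v2] ! k)
        ([w1, w2] ! k)"
      using D1 D2 by auto
    show "f \<cdot> [i1, i2] ! k = [j1, j2] ! k \<cdot> [u1, u2] ! k" using k fi by auto
  qed
  then show ?thesis unfolding direct_sum_iff_sum_decomp by (simp flip: numeral_2_eq_2)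
qed

text \<open>The zero morphism \<open>A \<rightarrow> B\<close> is the direct sum of \<open>A \<rightarrow> 0\<close> and \<open>0 \<rightarrow> B\<close>.\<close>

lemma dist_zero_direct_sum:
  assumes D: "Dist T A B X 0 g h"
  shows "direct_sum T [Susp T A, B] X"
proof -
  obtain Z where Z: "zero_object T Z" using zero_object_exists by blast
  then obtain h1 where D1: "Dist T A Z (Susp T A) 0 0 h1" using dist_zero_target by blast
  obtain i1 i2 p1 p2 where A: "biproduct A Z A i1 i2 p1 p2"
    using iso_imp_biproduct[OF isomorphic_refl Z] unfolding direct_sum_iff_biproduct by blast
  obtain j1 j2 q1 q2 where "biproduct B Z B j1 j2 q1 q2"
    using iso_imp_biproduct[OF isomorphic_refl Z] unfolding direct_sum_iff_biproduct by blast
  note B = biproduct_swap[OF this]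
  have "0 \<cdot> i1 = j2 \<cdot> 0" "0 \<cdot> i2 = j1 \<cdot> 0"
    using comp_zero_left[OF biproductD(1)[OF A]] comp_zero_left[OF biproductD(2)[OF A]]
      comp_zero_right[OF biproductD(1)[OF B]] comp_zero_right[OF biproductD(2)[OF B]] by simp_all
  then show ?thesis using direct_sum_cone[OF A B D D1 dist_zero_source[OF Z]] by blast
qed

end


section \<open>One-dimensional morphism spaces\<close>

context linear_category
begin

lemma gle_cong:
  assumes "isomorphic T P P'" "isomorphic T Q Q'" "gle T Q P"
  shows "gle T Q' P'"
proof -
  obtain a a' where a: "a \<in> Hom T P P'" "a' \<in> Hom T P' P" "a' \<cdot> a = Idn T P" "a \<cdot> a' = Idn T P'"
    using assms(1) unfolding isomorphic_def is_iso_def by blast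
  obtain b b' where b: "b \<in> Hom T Q Q'" "b' \<in> Hom T Q' Q" "b' \<cdot> b = Idn T Q" "b \<cdot> b' = Idn T Q'"
    using assms(2) unfolding isomorphic_def is_iso_def by blast
  obtain \<phi> where \<phi>: "bij_betw \<phi> (Hom T P Q) (UNIV :: 'k set)"
      "\<And>f g. \<lbrakk>f \<in> Hom T P Q; g \<in> Hom T P Q\<rbrakk> \<Longrightarrow> \<phi> (f + g) = \<phi> f + \<phi> g"
      "\<And>c f. f \<in> Hom T P Q \<Longrightarrow> \<phi> (Scale T c f) = c * \<phi> f"
    using assms(3) unfolding gle_def hom_iso_field_def by blast
  define \<theta> where "\<theta> f = b' \<cdot> (f \<cdot> a)" for f
  have fa: "f \<cdot> a \<in> Hom T P Q'" if "f \<in> Hom T P' Q'" for f by (rule comp_hom[OF a(1) that])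
  have \<theta>: "\<theta> f \<in> Hom T P Q" if "f \<in> Hom T P' Q'" for f
    unfolding \<theta>_def by (rule comp_hom[OF fa[OF that] b(2)])
  have transport: "b \<cdot> (g \<cdot> a') \<in> Hom T P' Q'" if "g \<in> Hom T P Q" for g
    by (rule comp_hom[OF comp_hom[OF a(2) that] b(1)])
  have 1: "b \<cdot> (\<theta> f \<cdot> a') = f" if f: "f \<in> Hom T P' Q'" for f
  proof -
    have "\<theta> f \<cdot> a' = b' \<cdot> f"
      unfolding \<theta>_def using comp_assoc[OF a(2) fa[OF f] b(2)] comp_assoc[OF a(2,1) f] a(4)
        comp_idn_right[OF f] by simp
    then show ?thesis using comp_assoc[OF f b(2,1)] b(4) comp_idn_left[OF f] by simp
  qed
  have 2: "\<theta> (b \<cdot> (g \<cdot> a')) = g" if g: "g \<in> Hom T P Q" for g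
  proof -
    have ga: "g \<cdot> a' \<in> Hom T P' Q" by (rule comp_hom[OF a(2) g])
    have "(b \<cdot> (g \<cdot> a')) \<cdot> a = b \<cdot> g"
      using comp_assoc[OF a(1) ga b(1)] comp_assoc[OF a(1,2) g] a(3) comp_idn_right[OF g] by simp
    then show ?thesis
      unfolding \<theta>_def using comp_assoc[OF g b(1,2)] b(3) comp_idn_left[OF g] by simp
  qed
  have "bij_betw \<theta> (Hom T P' Q') (Hom T P Q)"
    by (rule bij_betw_byWitness[where f' = "\<lambda>g. b \<cdot> (g \<cdot> a')"]) (use 1 2 \<theta> transport in auto)
  then have "bij_betw (\<phi> \<circ> \<theta>) (Hom T P' Q') UNIV" using \<phi>(1) by (rule bij_betw_trans)
  moreover have "\<theta> (f + g) = \<theta> f + \<theta> g" if "f \<in> Hom T P' Q'" "g \<in> Hom T P' Q'" for f g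
    unfolding \<theta>_def using comp_add_left[OF a(1) that] comp_add_right[OF fa fa b(2)] that by simp
  moreover have "\<theta> (Scale T c f) = Scale T c (\<theta> f)" if "f \<in> Hom T P' Q'" for c f
    unfolding \<theta>_def using comp_scale_left[OF a(1) that] comp_scale_right[OF fa b(2)] that by simp
  ultimately show ?thesis
    unfolding gle_def hom_iso_field_def using \<phi>(2,3) \<theta>
    by (intro exI[of _ "\<phi> \<circ> \<theta>"]) auto
qed

lemma gle_multiple:
  assumes "gle T Q P" "u \<in> Hom T P Q" "v \<in> Hom T P Q" "u \<noteq> 0"
  shows "\<exists>c. v = Scale T c u"
proof -
  obtain \<phi> where \<phi>: "bij_betw \<phi> (Hom T P Q) (UNIV :: 'k set)"
      "\<And>f g. \<lbrakk>f \<in> Hom T P Q; g \<in> Hom T P Q\<rbrakk> \<Longrightarrow> \<phi> (f + g) = \<phi> f + \<phi> g"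
      "\<And>c f. f \<in> Hom T P Q \<Longrightarrow> \<phi> (Scale T c f) = c * \<phi> f"
    using assms(1) unfolding gle_def hom_iso_field_def by blast
  have inj: "inj_on \<phi> (Hom T P Q)" using \<phi>(1) by (rule bij_betw_imp_inj_on)
  have "\<phi> 0 = 0" using \<phi>(3)[OF zero_hom, of 0] module.scale_zero_left[OF module_scale] by simp
  then have "\<phi> u \<noteq> 0" using inj_onD[OF inj _ assms(2) zero_hom] assms(4) by auto
  then have "\<phi> (Scale T (\<phi> v / \<phi> u) u) = \<phi> v" using \<phi>(3)[OF assms(2)] by simp
  then have "Scale T (\<phi> v / \<phi> u) u = v"
    by (rule inj_onD[OF inj _ scale_hom[OF assms(2)] assms(3)])
  then show ?thesis by metis
qed

lemma is_iso_scale: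
  assumes f: "is_iso T X Y f" and "c \<noteq> 0"
  shows "is_iso T X Y (Scale T c f)"
proof -
  obtain g where g: "f \<in> Hom T X Y" "g \<in> Hom T Y X" "g \<cdot> f = Idn T X" "f \<cdot> g = Idn T Y"
    using f unfolding is_iso_def by blast
  have *: "Scale T c (Scale T (1 / c) x) = x" "Scale T (1 / c) (Scale T c x) = x" for x
    using module.scale_scale[OF module_scale] module.scale_one[OF module_scale] assms(2) by simp_all
  have "Scale T (1 / c) g \<cdot> Scale T c f = Idn T X"
    using comp_scale_left[OF scale_hom[OF g(1)] g(2)] comp_scale_right[OF g(1,2)] g(3) * by simp
  moreover have "Scale T c f \<cdot> Scale T (1 / c) g = Idn T Y"
    using comp_scale_left[OF scale_hom[OF g(2)] g(1)] comp_scale_right[OF g(2,1)] g(4) * by simp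
  ultimately show ?thesis using is_isoI[OF scale_hom[OF g(1)] scale_hom[OF g(2)]] by blast
qed

text \<open>The identity is the sum of the idempotents that belong to two complementary summands. In a
  local endomorphism ring one of these is invertible.\<close>

lemma local_imp_indecomposable:
  assumes L: "local_endomorphism_ring T X"
  shows "indecomposable T X"
proof -
  \<comment> \<open>If the idempotent of a summand is invertible, then the complement is zero.\<close>
  have complement: "zero_object T B"
    if D: "biproduct A B X i j p q" and e: "is_iso T X X (i \<cdot> p)" for A B i j p q
  proof -
    note d = biproductD[OF D]
    obtain g where g: "g \<in> Hom T X X" "(i \<cdot> p) \<cdot> g = Idn T X" using e unfolding is_iso_def by blast
    have "q = q \<cdot> ((i \<cdot> p) \<cdot> g)" using g(2) comp_idn_right[OF d(4)] by simp
    also have "\<dots> = ((q \<cdot> i) \<cdot> p) \<cdot> g"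
      using comp_assoc[OF g(1) comp_hom[OF d(3,1)] d(4)] comp_assoc[OF d(3,1,4)] by simp
    also have "\<dots> = 0" using d(8) comp_zero_left[OF d(3)] comp_zero_left[OF g(1)] by simp
    finally show ?thesis using d(6) comp_zero_left[OF d(2)] unfolding zero_object_iff by simp
  qed
  have "zero_object T A \<or> zero_object T B" if sum: "direct_sum T [A, B] X" for A B
  proof -
    obtain i j p q where D: "biproduct A B X i j p q"
      using sum unfolding direct_sum_iff_biproduct by blast
    note d = biproductD[OF D]
    have "is_iso T X X (i \<cdot> p + j \<cdot> q)" using d(9) is_iso_idn by simp
    then have "is_iso T X X (i \<cdot> p) \<or> is_iso T X X (j \<cdot> q)"
      using L comp_hom[OF d(3,1)] comp_hom[OF d(4,2)] unfolding local_endomorphism_ring_def by blast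
    then show ?thesis using complement[OF D] complement[OF biproduct_swap[OF D]] by blast
  qed
  then show ?thesis
    using L unfolding indecomposable_def local_endomorphism_ring_def zero_object_iff by blast
qed

end


section \<open>The additive subcategory generated by an object\<close>

lemma gen1_memberI:
  assumes "\<And>S. \<lbrakk>additive_subcategory T S; summand_closed T S; susp_closed T S; G \<in> S\<rbrakk> \<Longrightarrow> A \<in> S"
  shows "A \<in> gen1 T G"
  unfolding gen1_def
proof (rule InterI)
  fix S assume "S \<in> {S. additive_subcategory T S \<and> summand_closed T S \<and> susp_closed T S \<and> G \<in> S}"
  then show "A \<in> S" using assms[of S] by simp
qed

lemma gen1_memberD:
  "\<lbrakk>A \<in> gen1 T G; additive_subcategory T S; summand_closed T S; susp_closed T S; G \<in> S\<rbrakk> \<Longrightarrow> A \<in> S"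
  unfolding gen1_def by simp

lemma gen1_direct_sum:
  assumes "direct_sum T [A, B] X" "A \<in> gen1 T G" "B \<in> gen1 T G"
  shows "X \<in> gen1 T G"
proof (rule gen1_memberI)
  fix S assume S: "additive_subcategory T S" "summand_closed T S" "susp_closed T S" "G \<in> S"
  have "A \<in> S" "B \<in> S" using gen1_memberD[OF _ S] assms(2,3) by simp_all
  then show "X \<in> S" using assms(1) S(1) unfolding additive_subcategory_def by blast
qed

lemma gen1_summand:
  assumes "direct_sum T [A, B] X" "X \<in> gen1 T G"
  shows "A \<in> gen1 T G" "B \<in> gen1 T G"
proof -
  have "A \<in> S \<and> B \<in> S"
    if S: "additive_subcategory T S" "summand_closed T S" "susp_closed T S" "G \<in> S" for S
    using assms(1) gen1_memberD[OF assms(2) S] S(2) unfolding summand_closed_def by blast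
  then show "A \<in> gen1 T G" "B \<in> gen1 T G" by (simp_all add: gen1_memberI)
qed

lemma gen1_susp: "Susp T A \<in> gen1 T G \<longleftrightarrow> A \<in> gen1 T G"
proof -
  have "Susp T A \<in> S \<longleftrightarrow> A \<in> S" if "susp_closed T S" for S
    using that unfolding susp_closed_def by blast
  then show ?thesis unfolding gen1_def by simp
qed

lemma (in linear_additive_category) gen1_iso:
  assumes "A \<in> gen1 T G" "isomorphic T A X"
  shows "X \<in> gen1 T G"
  using iso_imp_biproduct[OF isomorphic_sym[OF assms(2)]] zero_object_exists
    gen1_summand(1)[OF _ assms(1)] by blast

text \<open>The third object of the defining triangle is isomorphic to the suspension of an object \<open>A\<close>, and
  rotating the triangle backwards exhibits \<open>X\<close> as a cone.\<close>

lemma (in linear_triangulated_category) gen2_imp_cone: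
  assumes "X \<in> gen2 T G"
  shows "\<exists>A B f g h. A \<in> gen1 T G \<and> B \<in> gen1 T G \<and> Dist T A B X f g h"
proof -
  obtain B C g h k where B: "B \<in> gen1 T G" and C: "C \<in> gen1 T G" and D: "Dist T B X C g h k"
    using assms unfolding gen2_def by blast
  have d: "g \<in> Hom T B X" using dist_hom[OF D] by blast
  obtain A where A: "isomorphic T (Susp T A) C" using susp_essentially_surjective by blast
  have "Susp T A \<in> gen1 T G" by (rule gen1_iso[OF C isomorphic_sym[OF A]])
  then have "A \<in> gen1 T G" by (simp only: gen1_susp)
  obtain h' k' where D': "Dist T B X (Susp T A) g h' k'"
    using dist_iso_cone[OF D isomorphic_sym[OF A]] by blast
  have d': "h' \<in> Hom T X (Susp T A)" "k' \<in> Hom T (Susp T A) (Susp T B)"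
    using dist_hom[OF D'] by blast+
  have "- k' \<in> SuspM T ` Hom T A B"
    using uminus_hom[OF d'(2)] bij_betw_imp_surj_on[OF susp_fully_faithful[of A B]] by simp
  then obtain f where f: "f \<in> Hom T A B" "SuspM T f = - k'" by auto
  have "Dist T A B X f g h'" using TR2[OF f(1) d d'(1)] D' f(2) by simp
  with \<open>A \<in> gen1 T G\<close> B show ?thesis by blast
qed

lemma (in hom_finite_KS_triangulated_category) gen1_decomp:
  assumes "A \<in> gen1 T G"
  shows "\<exists>(n::nat) P i p. sum_decomp {..<n} P A i p \<and> (\<forall>k<n. P k \<in> ind1 T G)"
proof -
  obtain As where As: "\<And>B. B \<in> set As \<Longrightarrow> local_endomorphism_ring T B" "direct_sum T As A"
    using krull_schmidt by blast
  let ?I = "{..<length As}"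
  obtain i p where D: "sum_decomp ?I ((!) As) A i p"
    using As(2) unfolding direct_sum_iff_sum_decomp by blast
  have "As ! k \<in> ind1 T G" if k: "k < length As" for k
  proof -
    have "finite (?I - {k})" by simp
    from sum_decomp_exists[OF this] obtain X' i' p' where "sum_decomp (?I - {k}) ((!) As) X' i' p'"
      by blast
    moreover have "k \<in> ?I" using k by simp
    ultimately have "direct_sum T [As ! k, X'] A"
      using sum_decomp_split[OF D] unfolding direct_sum_iff_biproduct by blast
    then have "As ! k \<in> gen1 T G" using assms by (rule gen1_summand(1))
    then show ?thesis using local_imp_indecomposable[OF As(1)] k unfolding ind1_def by simp
  qed
  with D show ?thesis by blast
qed


section \<open>Diagonalising morphisms\<close>

lemma finite_minimal:
  assumes "finite S" "S \<noteq> {}"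
    and "\<And>x y. \<lbrakk>x \<in> S; y \<in> S\<rbrakk> \<Longrightarrow> R x y \<or> R y x"
    and "\<And>x y z. \<lbrakk>x \<in> S; y \<in> S; z \<in> S; R x y; R y z\<rbrakk> \<Longrightarrow> R x z"
  shows "\<exists>m\<in>S. \<forall>x\<in>S. R m x"
  using assms
proof (induction S rule: finite_ne_induct)
  case (singleton x)
  show ?case using singleton(1)[of x x] by simp
next
  case (insert x S)
  have "\<exists>m\<in>S. \<forall>y\<in>S. R m y"
  proof (rule insert.IH)
    show "R y z \<or> R z y" if "y \<in> S" "z \<in> S" for y z
      using insert.prems(1)[of y z] that by simp
    show "R y w" if "y \<in> S" "z \<in> S" "w \<in> S" "R y z" "R z w" for y z w
      using insert.prems(2)[of y z w] that by simp
  qed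
  then obtain m where m: "m \<in> S" "\<forall>y\<in>S. R m y" by blast
  show ?case
  proof (cases "R m x")
    case True
    with m show ?thesis by auto
  next
    case False
    then have xm: "R x m" using insert.prems(1)[of x m] m(1) by simp
    have "R x y" if "y \<in> S" for y using insert.prems(2)[of x m y] m xm that by simp
    moreover have "R x x" using insert.prems(1)[of x x] by simp
    ultimately show ?thesis by simp
  qed
qed

text \<open>A Hom-finite Krull-Schmidt triangulated category with a fixed linear generator, over an
  arbitrary field.\<close>

locale linear_generator_category = hom_finite_KS_triangulated_category T
  for T :: "('o, 'm::ab_group_add, 'k::field) tri_data" (structure) +
  fixes G :: 'o
  assumes linear_generator: "linear_generator T G"
begin

text \<open>The order on isomorphism classes of indecomposables, as a relation.\<close>

definition ind1_order :: "('o set \<times> 'o set) set" where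
  "ind1_order = {(iso_class T Q, iso_class T P) | Q P. Q \<in> ind1 T G \<and> P \<in> ind1 T G \<and> gle T Q P}"

lemma ind1_order_iff:
  assumes "P \<in> ind1 T G" "Q \<in> ind1 T G"
  shows "(iso_class T Q, iso_class T P) \<in> ind1_order \<longleftrightarrow> gle T Q P"
proof
  assume "(iso_class T Q, iso_class T P) \<in> ind1_order"
  then obtain Q' P' where "iso_class T Q = iso_class T Q'" "iso_class T P = iso_class T P'" "gle T Q' P'"
    unfolding ind1_order_def by auto
  then show "gle T Q P"
    using gle_cong[of P' P Q' Q] iso_class_eq_iff[of Q' Q] iso_class_eq_iff[of P' P] by simp
next
  assume "gle T Q P"
  then show "(iso_class T Q, iso_class T P) \<in> ind1_order"
    using assms unfolding ind1_order_def by blast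
qed

lemma ind1_linear_order: "linear_order_on (iso_class T ` ind1 T G) ind1_order"
  using linear_generator unfolding linear_generator_def ind1_order_def by (elim conjE)

lemma gle_total:
  assumes P: "P \<in> ind1 T G" and Q: "Q \<in> ind1 T G"
  shows "gle T Q P \<or> gle T P Q"
proof -
  have r: "refl_on (iso_class T ` ind1 T G) ind1_order" "total_on (iso_class T ` ind1 T G) ind1_order"
    using ind1_linear_order by (simp_all add: order_on_defs)
  have "(iso_class T Q, iso_class T P) \<in> ind1_order \<or> (iso_class T P, iso_class T Q) \<in> ind1_order"
  proof (cases "iso_class T Q = iso_class T P")
    case True
    then show ?thesis using refl_onD[OF r(1) imageI[OF P]] by simp
  next
    case False
    then show ?thesis using r(2) P Q unfolding total_on_def by simp
  qed
  then show ?thesis using ind1_order_iff[OF P Q] ind1_order_iff[OF Q P] by simp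
qed

lemma gle_trans:
  assumes P: "P \<in> ind1 T G" and Q: "Q \<in> ind1 T G" and R: "R \<in> ind1 T G"
    and "gle T R Q" "gle T Q P"
  shows "gle T R P"
proof -
  have "trans ind1_order" using ind1_linear_order by (simp add: order_on_defs)
  then have "(iso_class T R, iso_class T P) \<in> ind1_order"
    using ind1_order_iff[OF Q R] ind1_order_iff[OF P Q] assms(4,5) by (blast dest: transD)
  then show ?thesis using ind1_order_iff[OF P R] by simp
qed

lemma gle_minimal:
  assumes "S \<noteq> {}" "finite S" and P: "\<And>k. k \<in> S \<Longrightarrow> P k \<in> ind1 T G"
  shows "\<exists>m\<in>S. \<forall>k\<in>S. gle T (P m) (P k)"
proof (rule finite_minimal[OF assms(2,1)])
  show "gle T (P x) (P y) \<or> gle T (P y) (P x)" if "x \<in> S" "y \<in> S" for x y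
    by (rule gle_total[OF P[OF that(2)] P[OF that(1)]])
  show "gle T (P x) (P z)"
    if "x \<in> S" "y \<in> S" "z \<in> S" "gle T (P x) (P y)" "gle T (P y) (P z)" for x y z
    by (rule gle_trans[OF P[OF that(3)] P[OF that(2)] P[OF that(1)] that(4,5)])
qed

lemma gle_maximal:
  assumes "S \<noteq> {}" "finite S" and P: "\<And>k. k \<in> S \<Longrightarrow> P k \<in> ind1 T G"
  shows "\<exists>m\<in>S. \<forall>k\<in>S. gle T (P k) (P m)"
proof (rule finite_minimal[OF assms(2,1)])
  show "gle T (P y) (P x) \<or> gle T (P x) (P y)" if "x \<in> S" "y \<in> S" for x y
    by (rule gle_total[OF P[OF that(1)] P[OF that(2)]])
  show "gle T (P z) (P x)"
    if "x \<in> S" "y \<in> S" "z \<in> S" "gle T (P y) (P x)" "gle T (P z) (P y)" for x y z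
    by (rule gle_trans[OF P[OF that(1)] P[OF that(2)] P[OF that(3)] that(5,4)])
qed

lemma hom_zero_if_glt:
  assumes "P \<in> ind1 T G" "Q \<in> ind1 T G" "gle T Q P" "\<not> isomorphic T Q P"
  shows "Hom T Q P = {0}"
proof -
  have "\<forall>P\<in>ind1 T G. \<forall>Q\<in>ind1 T G. gle T Q P \<and> \<not> isomorphic T Q P \<longrightarrow> Hom T Q P = {0}"
    using linear_generator unfolding linear_generator_def by (elim conjE)
  with assms show ?thesis by simp
qed

lemma factor_through:
  assumes "P \<in> ind1 T G" "Q \<in> ind1 T G" "R \<in> ind1 T G" "gle T R Q" "gle T Q P"
    and "f \<in> Hom T P R" "f \<noteq> 0"
  obtains g h where "g \<in> Hom T P Q" "h \<in> Hom T Q R" "f = h \<cdot> g"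
proof -
  have "\<forall>P\<in>ind1 T G. \<forall>Q\<in>ind1 T G. \<forall>R\<in>ind1 T G. gle T R Q \<and> gle T Q P \<longrightarrow>
        (\<forall>f\<in>Hom T P R. f \<noteq> 0 \<longrightarrow> (\<exists>g\<in>Hom T P Q. \<exists>h\<in>Hom T Q R. f = h \<cdot> g))"
    using linear_generator unfolding linear_generator_def by (elim conjE)
  then have "\<exists>g\<in>Hom T P Q. \<exists>h\<in>Hom T Q R. f = h \<cdot> g" using assms by simp
  then show ?thesis using that by auto
qed

text \<open>By totality \<open>P < Q\<close> otherwise, and then there are no nonzero morphisms \<open>P \<rightarrow> Q\<close>.\<close>

lemma gle_if_nonzero:
  assumes "P \<in> ind1 T G" "Q \<in> ind1 T G" "u \<in> Hom T P Q" "u \<noteq> 0"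
  shows "gle T Q P"
proof (rule ccontr)
  assume not: "\<not> gle T Q P"
  then have "gle T P Q" using gle_total[OF assms(1,2)] by simp
  moreover have "\<not> isomorphic T P Q"
    using not gle_total[OF assms(1,1)] gle_cong[OF isomorphic_refl, of P Q P] by auto
  ultimately have "Hom T P Q = {0}"
    using hom_zero_if_glt[OF assms(2,1)] by simp
  then show False using assms(3,4) by simp
qed

text \<open>As the morphism spaces are one-dimensional, the factor between comparable objects may be any
  prescribed nonzero morphism \<open>u\<close>.\<close>

lemma factor_right:
  assumes "P \<in> ind1 T G" "Q \<in> ind1 T G" "R \<in> ind1 T G"
    and "gle T R Q" "u \<in> Hom T P Q" "u \<noteq> 0" "x \<in> Hom T P R"
  shows "\<exists>b\<in>Hom T Q R. x = b \<cdot> u"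
proof (cases "x = 0")
  case True
  then show ?thesis using zero_hom comp_zero_left[OF assms(5)] by metis
next
  case False
  have PQ: "gle T Q P" by (rule gle_if_nonzero[OF assms(1,2,5,6)])
  obtain g h where g: "g \<in> Hom T P Q" and h: "h \<in> Hom T Q R" and x: "x = h \<cdot> g"
    using factor_through[OF assms(1-4) PQ assms(7) False] .
  obtain c where "g = Scale T c u" using gle_multiple[OF PQ assms(5) g assms(6)] by blast
  then have "x = Scale T c h \<cdot> u"
    using x comp_scale_left[OF assms(5) h] comp_scale_right[OF assms(5) h] by simp
  then show ?thesis using scale_hom[OF h] by blast
qed

lemma factor_left:
  assumes "P \<in> ind1 T G" "Q \<in> ind1 T G" "R \<in> ind1 T G"
    and "gle T Q P" "u \<in> Hom T Q R" "u \<noteq> 0" "x \<in> Hom T P R"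
  shows "\<exists>a\<in>Hom T P Q. x = u \<cdot> a"
proof (cases "x = 0")
  case True
  then show ?thesis using zero_hom comp_zero_right[OF assms(5)] by metis
next
  case False
  have QR: "gle T R Q" by (rule gle_if_nonzero[OF assms(2,3,5,6)])
  obtain g h where g: "g \<in> Hom T P Q" and h: "h \<in> Hom T Q R" and x: "x = h \<cdot> g"
    using factor_through[OF assms(1-3) QR assms(4,7) False] .
  obtain c where "h = Scale T c u" using gle_multiple[OF QR assms(5) h assms(6)] by blast
  then have "x = u \<cdot> Scale T c g"
    using x comp_scale_left[OF g assms(5)] comp_scale_right[OF g assms(5)] by simp
  then show ?thesis using scale_hom[OF g] by blast
qed

text \<open>
  A nonzero entry \<open>q b \<cdot> f \<cdot> i a\<close> of the matrix of \<open>f\<close> that divides all other entries in its row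
  and its column: choose first the source \<open>P a\<close> minimal and then the target \<open>Q b\<close> maximal. The
  morphisms \<open>\<alpha>\<close> and \<open>\<beta>\<close> assemble the quotients, with an identity at the position of the pivot
  \<open>u\<close>; so \<open>\<alpha>\<close> is a retraction of \<open>i a\<close> and \<open>\<beta>\<close> is a section of \<open>q b\<close>.
\<close>

lemma pivot:
  assumes DA: "sum_decomp I P A i p" and DB: "sum_decomp J Q B j q"
    and P: "\<And>k. k \<in> I \<Longrightarrow> P k \<in> ind1 T G" and Q: "\<And>k. k \<in> J \<Longrightarrow> Q k \<in> ind1 T G"
    and f: "f \<in> Hom T A B" "f \<noteq> 0"
  shows "\<exists>a\<in>I. \<exists>b\<in>J. \<exists>u\<in>Hom T (P a) (Q b). \<exists>\<alpha>\<in>Hom T A (P a). \<exists>\<beta>\<in>Hom T (Q b) B.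
    u \<noteq> 0 \<and> \<alpha> \<cdot> i a = Idn T (P a) \<and> q b \<cdot> \<beta> = Idn T (Q b) \<and> f \<cdot> i a = \<beta> \<cdot> u \<and> q b \<cdot> f = u \<cdot> \<alpha>"
proof -
  note a = sum_decompD[OF DA] and b = sum_decompD[OF DB]
  have fi: "f \<cdot> i k \<in> Hom T (P k) B" if "k \<in> I" for k by (rule comp_hom[OF a(2)[OF that] f(1)])
  have qfi: "q l \<cdot> (f \<cdot> i k) \<in> Hom T (P k) (Q l)" if "k \<in> I" "l \<in> J" for k l
    by (rule comp_hom[OF fi[OF that(1)] b(3)[OF that(2)]])
  have f_sum: "x = (\<Sum>k\<in>I. (x \<cdot> i k) \<cdot> p k)" if x: "x \<in> Hom T A Y" for x Y
  proof -
    have "x = x \<cdot> (\<Sum>k\<in>I. i k \<cdot> p k)" using a(6) comp_idn_right[OF x] by simp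
    also have "\<dots> = (\<Sum>k\<in>I. x \<cdot> (i k \<cdot> p k))"
      by (rule comp_sum_right[OF x]) (rule comp_hom[OF a(3) a(2)])
    finally show ?thesis using comp_assoc[OF a(3) a(2) x] by simp
  qed
  have g_sum: "x = (\<Sum>l\<in>J. j l \<cdot> (q l \<cdot> x))" if x: "x \<in> Hom T Y B" for x Y
  proof -
    have "x = (\<Sum>l\<in>J. j l \<cdot> q l) \<cdot> x" using b(6) comp_idn_left[OF x] by simp
    also have "\<dots> = (\<Sum>l\<in>J. (j l \<cdot> q l) \<cdot> x)"
      by (rule comp_sum_left[OF x]) (rule comp_hom[OF b(3) b(2)])
    finally show ?thesis using comp_assoc[OF x b(3) b(2)] by simp
  qed
  let ?S = "{k \<in> I. f \<cdot> i k \<noteq> 0}"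
  have "?S \<noteq> {}"
  proof
    assume "?S = {}"
    then have "(f \<cdot> i k) \<cdot> p k = 0" if "k \<in> I" for k using that comp_zero_left[OF a(3)[OF that]] by auto
    then show False using f_sum[OF f(1)] f(2) by simp
  qed
  moreover have "finite ?S" "\<And>k. k \<in> ?S \<Longrightarrow> P k \<in> ind1 T G" using a(1) P by simp_all
  ultimately have "\<exists>m\<in>?S. \<forall>k\<in>?S. gle T (P m) (P k)" by (rule gle_minimal)
  then obtain m where m: "m \<in> I" "f \<cdot> i m \<noteq> 0"
    and m_min: "\<And>k. \<lbrakk>k \<in> I; f \<cdot> i k \<noteq> 0\<rbrakk> \<Longrightarrow> gle T (P m) (P k)" by blast
  let ?R = "{l \<in> J. q l \<cdot> (f \<cdot> i m) \<noteq> 0}"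
  have "?R \<noteq> {}"
  proof
    assume "?R = {}"
    then have "j l \<cdot> (q l \<cdot> (f \<cdot> i m)) = 0" if "l \<in> J" for l
      using that comp_zero_right[OF b(2)[OF that]] by auto
    then show False using g_sum[OF fi[OF m(1)]] m(2) by simp
  qed
  moreover have "finite ?R" "\<And>l. l \<in> ?R \<Longrightarrow> Q l \<in> ind1 T G" using b(1) Q by simp_all
  ultimately have "\<exists>n\<in>?R. \<forall>l\<in>?R. gle T (Q l) (Q n)" by (rule gle_maximal)
  then obtain n where n: "n \<in> J" "q n \<cdot> (f \<cdot> i m) \<noteq> 0"
    and n_max: "\<And>l. \<lbrakk>l \<in> J; q l \<cdot> (f \<cdot> i m) \<noteq> 0\<rbrakk> \<Longrightarrow> gle T (Q l) (Q n)" by blast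
  define u where "u = q n \<cdot> (f \<cdot> i m)"
  have u: "u \<in> Hom T (P m) (Q n)" "u \<noteq> 0" unfolding u_def using qfi[OF m(1) n(1)] n(2) by auto
  have "\<exists>\<beta>\<in>Hom T (Q n) (Q l). q l \<cdot> (f \<cdot> i m) = \<beta> \<cdot> u \<and> (l = n \<longrightarrow> \<beta> = Idn T (Q n))" if l: "l \<in> J" for l
  proof (cases "l = n \<or> q l \<cdot> (f \<cdot> i m) = 0")
    case True
    then show ?thesis
      using idn_hom[of "Q n"] comp_idn_left[OF u(1)] comp_zero_left[OF u(1)] zero_hom n(2)
      unfolding u_def by metis
  next
    case False
    then show ?thesis
      using factor_right[OF P[OF m(1)] Q[OF n(1)] Q[OF l] n_max[OF l] u qfi[OF m(1) l]] by blast
  qed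
  then obtain \<beta> where \<beta>: "\<And>l. l \<in> J \<Longrightarrow> \<beta> l \<in> Hom T (Q n) (Q l)" "\<beta> n = Idn T (Q n)"
    "\<And>l. l \<in> J \<Longrightarrow> q l \<cdot> (f \<cdot> i m) = \<beta> l \<cdot> u" using n(1) by metis
  have "\<exists>\<alpha>\<in>Hom T (P k) (P m). q n \<cdot> (f \<cdot> i k) = u \<cdot> \<alpha> \<and> (k = m \<longrightarrow> \<alpha> = Idn T (P m))" if k: "k \<in> I" for k
  proof (cases "k = m \<or> q n \<cdot> (f \<cdot> i k) = 0")
    case True
    then show ?thesis
      using idn_hom[of "P m"] comp_idn_right[OF u(1)] comp_zero_right[OF u(1)] zero_hom n(2)
      unfolding u_def by metis
  next
    case False
    then have "f \<cdot> i k \<noteq> 0" using comp_zero_right[OF b(3)[OF n(1)]] by auto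
    with False show ?thesis
      using factor_left[OF P[OF k] P[OF m(1)] Q[OF n(1)] m_min[OF k] u qfi[OF k n(1)]] by blast
  qed
  then obtain \<alpha> where \<alpha>: "\<And>k. k \<in> I \<Longrightarrow> \<alpha> k \<in> Hom T (P k) (P m)" "\<alpha> m = Idn T (P m)"
    "\<And>k. k \<in> I \<Longrightarrow> q n \<cdot> (f \<cdot> i k) = u \<cdot> \<alpha> k" using m(1) by metis
  define \<beta>' where "\<beta>' = (\<Sum>l\<in>J. j l \<cdot> \<beta> l)"
  define \<alpha>' where "\<alpha>' = (\<Sum>k\<in>I. \<alpha> k \<cdot> p k)"
  have \<beta>': "\<beta>' \<in> Hom T (Q n) B" unfolding \<beta>'_def by (rule sum_hom) (rule comp_hom[OF \<beta>(1) b(2)])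
  have \<alpha>': "\<alpha>' \<in> Hom T A (P m)" unfolding \<alpha>'_def by (rule sum_hom) (rule comp_hom[OF a(3) \<alpha>(1)])
  have "f \<cdot> i m = (\<Sum>l\<in>J. (j l \<cdot> \<beta> l) \<cdot> u)"
    using g_sum[OF fi[OF m(1)]] \<beta>(3) comp_assoc[OF u(1) \<beta>(1) b(2)] by simp
  also have "\<dots> = \<beta>' \<cdot> u"
    unfolding \<beta>'_def by (rule comp_sum_left[OF u(1), symmetric]) (rule comp_hom[OF \<beta>(1) b(2)])
  finally have 1: "f \<cdot> i m = \<beta>' \<cdot> u" .
  have "q n \<cdot> f = (\<Sum>k\<in>I. (q n \<cdot> (f \<cdot> i k)) \<cdot> p k)"
    using f_sum[OF comp_hom[OF f(1) b(3)[OF n(1)]]] comp_assoc[OF a(2) f(1) b(3)[OF n(1)]] by simp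
  also have "\<dots> = (\<Sum>k\<in>I. u \<cdot> (\<alpha> k \<cdot> p k))"
    using \<alpha>(3) comp_assoc[OF a(3) \<alpha>(1) u(1)] by simp
  also have "\<dots> = u \<cdot> \<alpha>'"
    unfolding \<alpha>'_def by (rule comp_sum_right[OF u(1), symmetric]) (rule comp_hom[OF a(3) \<alpha>(1)])
  finally have 2: "q n \<cdot> f = u \<cdot> \<alpha>'" .
  have "q n \<cdot> \<beta>' = (\<Sum>l\<in>J. q n \<cdot> (j l \<cdot> \<beta> l))"
    unfolding \<beta>'_def by (rule comp_sum_right[OF b(3)[OF n(1)]]) (rule comp_hom[OF \<beta>(1) b(2)])
  also have "\<dots> = (\<Sum>l\<in>J. if l = n then Idn T (Q n) else 0)"
  proof (rule sum.cong[OF refl])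
    fix l assume l: "l \<in> J"
    show "q n \<cdot> (j l \<cdot> \<beta> l) = (if l = n then Idn T (Q n) else 0)"
      using comp_assoc[OF \<beta>(1)[OF l] b(2)[OF l] b(3)[OF n(1)]] b(4)[OF n(1)] b(5)[OF n(1) l] \<beta>(2)
        comp_idn_left[OF idn_hom] comp_zero_left[OF \<beta>(1)[OF l]] by auto
  qed
  finally have 3: "q n \<cdot> \<beta>' = Idn T (Q n)" using b(1) n(1) by simp
  have "\<alpha>' \<cdot> i m = (\<Sum>k\<in>I. (\<alpha> k \<cdot> p k) \<cdot> i m)"
    unfolding \<alpha>'_def by (rule comp_sum_left[OF a(2)[OF m(1)]]) (rule comp_hom[OF a(3) \<alpha>(1)])
  also have "\<dots> = (\<Sum>k\<in>I. if k = m then Idn T (P m) else 0)"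
  proof (rule sum.cong[OF refl])
    fix k assume k: "k \<in> I"
    show "(\<alpha> k \<cdot> p k) \<cdot> i m = (if k = m then Idn T (P m) else 0)"
      using comp_assoc[OF a(2)[OF m(1)] a(3)[OF k] \<alpha>(1)[OF k]] a(4)[OF m(1)] a(5)[OF k m(1)] \<alpha>(2)
        comp_idn_left[OF idn_hom] comp_zero_right[OF \<alpha>(1)[OF k]] by auto
  qed
  finally have 4: "\<alpha>' \<cdot> i m = Idn T (P m)" using a(1) m(1) by simp
  show ?thesis using m(1) n(1) u \<alpha>' \<beta>' 1 2 3 4 by blast
qed

text \<open>If \<open>P\<close> and \<open>Q\<close> were isomorphic, then \<open>u\<close>, being a multiple of an isomorphism, would be
  invertible with zero cone.\<close>

lemma nonzero_cone:
  assumes P: "P \<in> ind1 T G" and Q: "Q \<in> ind1 T G" and D: "Dist T P Q X u g h" and "u \<noteq> 0"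
    and X: "\<not> zero_object T X"
  shows "glt T Q P \<and> isomorphic T X (cone_obj T P Q)"
proof -
  have u: "u \<in> Hom T P Q" using dist_hom[OF D] by blast
  have QP: "gle T Q P" by (rule gle_if_nonzero[OF P Q u assms(4)])
  have "\<not> isomorphic T Q P"
  proof
    assume "isomorphic T Q P"
    then obtain w where w: "is_iso T P Q w" using isomorphic_sym unfolding isomorphic_def by blast
    then have wh: "w \<in> Hom T P Q" unfolding is_iso_def by blast
    obtain c where c: "w = Scale T c u" using gle_multiple[OF QP u wh assms(4)] by blast
    have "Idn T P \<noteq> 0" using P unfolding ind1_def indecomposable_def zero_object_iff by blast
    then have "w \<noteq> 0" using w comp_zero_right unfolding is_iso_def by metis
    then obtain c' where c': "u = Scale T c' w" using gle_multiple[OF QP wh u] by blast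
    have "c' \<noteq> 0" using c' assms(4) module.scale_zero_left[OF module_scale] by metis
    then have "is_iso T P Q u" using is_iso_scale[OF w] c' by blast
    then show False using cone_of_iso_zero[OF D] X by blast
  qed
  then have 1: "glt T Q P" unfolding glt_def using QP by blast
  have "\<exists>f\<in>Hom T P Q. f \<noteq> 0 \<and> (\<exists>g h. Dist T P Q X f g h)" using D u assms(4) by blast
  then have "\<exists>f\<in>Hom T P Q. f \<noteq> 0 \<and> (\<exists>g h. Dist T P Q (cone_obj T P Q) f g h)"
    unfolding cone_obj_def by (rule someI)
  then obtain f g' h' where f: "f \<in> Hom T P Q" "f \<noteq> 0" and D': "Dist T P Q (cone_obj T P Q) f g' h'"
    by blast
  obtain c where c: "f = Scale T c u" using gle_multiple[OF QP u f(1) assms(4)] by blast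
  have "c \<noteq> 0" using c f(2) module.scale_zero_left[OF module_scale] by metis
  then have s: "is_iso T Q Q (Scale T c (Idn T Q))" by (rule is_iso_scale[OF is_iso_idn])
  have "Scale T c (Idn T Q) \<cdot> u = f \<cdot> Idn T P"
    using c comp_scale_left[OF u idn_hom] comp_idn_left[OF u] comp_idn_right[OF f(1)] by simp
  then have "isomorphic T X (cone_obj T P Q)" by (rule cones_isomorphic[OF D D' is_iso_idn s])
  with 1 show ?thesis by blast
qed

text \<open>Each elimination step lowers the number of summands of the source.\<close>

lemma indecomposable_cone:
  assumes "sum_decomp I P A i p" "sum_decomp J Q B j q"
    and "\<And>k. k \<in> I \<Longrightarrow> P k \<in> ind1 T G" "\<And>k. k \<in> J \<Longrightarrow> Q k \<in> ind1 T G"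
    and "A \<in> gen1 T G" "B \<in> gen1 T G" "Dist T A B X f g h" "indecomposable T X"
  shows "X \<in> gen1 T G \<or>
    (\<exists>P\<in>ind1 T G. \<exists>Q\<in>ind1 T G. glt T Q P \<and> isomorphic T X (cone_obj T P Q))"
  using assms
proof (induction "card I" arbitrary: I A i p J B j q f g h rule: less_induct)
  case less
  note DA = less.prems(1) and DB = less.prems(2) and P = less.prems(3) and Q = less.prems(4)
    and AB = less.prems(5,6) and D = less.prems(7) and X = less.prems(8)
  have f: "f \<in> Hom T A B" using dist_hom[OF D] by blast
  show ?case
  proof (cases "f = 0")
    case True
    then have "direct_sum T [Susp T A, B] X" using dist_zero_direct_sum D by simp
    then have "X \<in> gen1 T G" by (rule gen1_direct_sum) (simp_all add: gen1_susp AB)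
    then show ?thesis by blast
  next
    case False
    obtain a b u \<alpha> \<beta> where ab: "a \<in> I" "b \<in> J" and u: "u \<in> Hom T (P a) (Q b)" "u \<noteq> 0"
      and \<alpha>: "\<alpha> \<in> Hom T A (P a)" "\<alpha> \<cdot> i a = Idn T (P a)"
      and \<beta>: "\<beta> \<in> Hom T (Q b) B" "q b \<cdot> \<beta> = Idn T (Q b)"
      and fu: "f \<cdot> i a = \<beta> \<cdot> u" "q b \<cdot> f = u \<cdot> \<alpha>"
      using pivot[OF DA DB P Q f False] by blast
    have fin: "finite (I - {a})" "finite (J - {b})"
      using sum_decompD(1)[OF DA] sum_decompD(1)[OF DB] by auto
    obtain A' i' p' where DA': "sum_decomp (I - {a}) P A' i' p'" using sum_decomp_exists[OF fin(1)] by blast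
    obtain B' j' q' where DB': "sum_decomp (J - {b}) Q B' j' q'" using sum_decomp_exists[OF fin(2)] by blast
    obtain s r where "biproduct (P a) A' A (i a) s (p a) r"
      using sum_decomp_split[OF DA ab(1) DA'] by blast
    then obtain s where A: "biproduct (P a) A' A (i a) s \<alpha> r"
      using biproduct_change_retraction \<alpha> by blast
    obtain t v where "biproduct (Q b) B' B (j b) t (q b) v"
      using sum_decomp_split[OF DB ab(2) DB'] by blast
    then obtain v where B: "biproduct (Q b) B' B \<beta> t (q b) v"
      using biproduct_change_section \<beta> by blast
    define f' where "f' = v \<cdot> (f \<cdot> s)"
    have f': "f' \<in> Hom T A' B'"
      unfolding f'_def using comp_hom[OF comp_hom[OF biproductD(2)[OF A] f] biproductD(4)[OF B]] .
    have fs: "f \<cdot> s = t \<cdot> f'" unfolding f'_def by (rule diagonal_block[OF A B f u(1) fu(2)])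
    obtain X1 g1 h1 where D1: "Dist T (P a) (Q b) X1 u g1 h1" using TR1_cone[OF u(1)] by blast
    obtain X2 g2 h2 where D2: "Dist T A' B' X2 f' g2 h2" using TR1_cone[OF f'] by blast
    have sum: "direct_sum T [X1, X2] X" by (rule direct_sum_cone[OF A B D D1 D2 fu(1) fs])
    then obtain c1 c2 d1 d2 where XD: "biproduct X1 X2 X c1 c2 d1 d2"
      unfolding direct_sum_iff_biproduct by blast
    have "zero_object T X1 \<or> zero_object T X2" using X sum unfolding indecomposable_def by blast
    then show ?thesis
    proof
      assume "zero_object T X2"
      then have "isomorphic T X1 X" by (rule biproduct_zero_iso[OF XD])
      then obtain g' h' where "Dist T (P a) (Q b) X u g' h'" using dist_iso_cone[OF D1] by blast
      then show ?thesis
        using nonzero_cone[OF P[OF ab(1)] Q[OF ab(2)] _ u(2)] X P[OF ab(1)] Q[OF ab(2)]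
        unfolding indecomposable_def by blast
    next
      assume "zero_object T X1"
      then have "isomorphic T X2 X" by (rule biproduct_zero_iso[OF biproduct_swap[OF XD]])
      then obtain g' h' where D': "Dist T A' B' X f' g' h'" using dist_iso_cone[OF D2] by blast
      have "card (I - {a}) < card I" by (rule card_Diff1_less[OF sum_decompD(1)[OF DA] ab(1)])
      moreover have "direct_sum T [P a, A'] A" "direct_sum T [Q b, B'] B"
        using A B unfolding direct_sum_iff_biproduct by blast+
      then have "A' \<in> gen1 T G" "B' \<in> gen1 T G"
        using gen1_summand(2) AB by metis+
      ultimately show ?thesis
        using less.hyps[OF _ DA' DB' _ _ _ _ D' X] P Q by blast
    qed
  qed
qed

end

theorem proposition2p10:
  fixes T :: "('o, 'm::ab_group_add, 'k::alg_closed_field) tri_data"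
    and G X :: 'o
  assumes "hom_finite_KS_triangulated_category T"
    and "linear_generator T G"
    and "X \<in> gen2 T G"
    and "indecomposable T X"
  shows "(\<exists>P\<in>gen1 T G. isomorphic T X P) \<or>
         (\<exists>P\<in>ind1 T G. \<exists>Q\<in>ind1 T G. glt T Q P \<and> isomorphic T X (cone_obj T P Q))"
proof -
  interpret linear_generator_category T G
    using assms(1,2) by (simp add: linear_generator_category_def linear_generator_category_axioms_def)
  obtain A B f g h where A: "A \<in> gen1 T G" and B: "B \<in> gen1 T G" and D: "Dist T A B X f g h"
    using gen2_imp_cone[OF assms(3)] by blast
  obtain m :: nat and P i p where DA: "sum_decomp {..<m} P A i p" "\<forall>k<m. P k \<in> ind1 T G"
    using gen1_decomp[OF A] by blast
  obtain n :: nat and Q j q where DB: "sum_decomp {..<n} Q B j q" "\<forall>k<n. Q k \<in> ind1 T G"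
    using gen1_decomp[OF B] by blast
  show ?thesis
    using indecomposable_cone[OF DA(1) DB(1) _ _ A B D assms(4)] DA(2) DB(2) isomorphic_refl by blast
qed

end
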